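(* Consider the problem $\min\{f(x):x\in X,\ g(x)\le0\}$ with a solution $x_*$. Assume that for some constants $M_f,M_g$ $$|f(x)-f(y)|\le M_f\|x-y\|_E,\qquad |g(x)-g(y)|\le M_g\|x-y\|_E\qquad\text{for all }x,y\in X,$$ and that $f$ and $g$ are strongly convex with the same parameter $\mu$. Also assume that the prox-function $d$ satisfies $d(x)\le\frac{\Omega}{2}$ for all $x\in X$ with $\|x\|_E\le1$, where $\Omega$ is a known number, and that the starting point $x_0\in X$ and the number $R_0>0$ are such that $\|x_0-x_*\|_E^2\le R_0^2$. Let $\varepsilon>0$. Then the point $x_p$ returned by the restarted Adaptive Mirror Descent algorithm (described in the context) is an $\varepsilon$-solution of the problem, i.e. $$f(x_p)-f(x_* )\le\varepsilon,\qquad g(x_p)\le\varepsilon,$$ and $$\|x_p-x_*\|_E^2\le\frac{2\varepsilon}{\mu}.$$ At the same time, the total number of iterations of the inner algorithm (Adaptive Mirror Descent) does not exceed $$\left\lceil\log_2\frac{\mu R_0^2}{2\varepsilon}\right\rceil+\frac{32\,\Omega\max\{M_f^2,M_g^2\}}{\mu\varepsilon}.$$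
   Context: **Problem.** $E$ is a finite-dimensional real vector space with norm $\|\cdot\|_E$, $E^*$ its dual, $\langle p,x\rangle$ the value of $p\in E^*$ at $x\in E$, and $\|p\|_{E,*}=\max\{\langle p,x\rangle:\|x\|_E\le1\}$. $X\subset E$ is closed and convex; $f:X\to\mathbb{R}$ and $g:E\to\mathbb{R}$ are convex. The problem is regular: there is a point $\bar x$ in the relative interior of $X$ with $g(\bar x)<0$. $\nabla f(x)$, $\nabla g(x)$ denote any subgradients of $f$, $g$ at $x$. Strong convexity of $f$ with parameter $\mu$ means $f(y)\ge f(x)+\langle\nabla f(x),y-x\rangle+\frac\mu2\|y-x\|_E^2$ for all $x,y\in X$; similarly for $g$. **Prox-function.** $d$ is continuous and convex on $X$; on the set $X^0\subseteq X$ of points where a subgradient of $d$ exists it admits a continuous selection of subgradients $\nabla d(x)$; it is 1-strongly convex on $X$ with respect to $\|\cdot\|_E$: $d(y)-d(x)-\langle\nabla d(x),y-x\rangle\ge\frac12\|y-x\|_E^2$ for $x\in X^0,y\in X$; $\min_{x\in X}d(x)=0$; and $0=\arg\min_{x\in X}d(x)$. **Inner algorithm (Adaptive Mirror Descent).** Inputs: accuracy $\delta>0$, a number $\Theta_0^2$, a norm with dual norm $\|\cdot\|_*$, and a prox-function $\tilde d$ that is 1-strongly convex with respect to that norm. Put $\mathrm{Mirr}[x](p)=\arg\min_{u\in X}\{\langle p,u\rangle+\tilde d(u)-\langle\nabla\tilde d(x),u\rangle\}$, assumed to be easily computable. Start with $x^0=\arg\min_{x\in X}\tilde d(x)$, $I=\emptyset$,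 $k=0$. Repeat: if $g(x^k)\le\delta$, set $M_k=\|\nabla f(x^k)\|_{*}$, $h_k=\delta/M_k^2$, $x^{k+1}=\mathrm{Mirr}[x^k](h_k\nabla f(x^k))$ and add $k$ to $I$; otherwise set $M_k=\|\nabla g(x^k)\|_{*}$, $h_k=\delta/M_k^2$, $x^{k+1}=\mathrm{Mirr}[x^k](h_k\nabla g(x^k))$; then $k\leftarrow k+1$; until $\sum_{j=0}^{k-1}M_j^{-2}\ge2\Theta_0^2/\delta^2$. Output $\frac{\sum_{i\in I}h_ix^i}{\sum_{i\in I}h_i}$. **Restarted algorithm.** Set $d_0(x)=d\big(\frac{x-x_0}{R_0}\big)$. For $p=1,2,\dots$: set $R_p^2=R_0^2\,2^{-p}$ and $\varepsilon_p=\frac{\mu R_p^2}{2}$; let $x_p$ be the output of the inner algorithm with accuracy $\varepsilon_p$, prox-function $d_{p-1}$ (with respect to the norm $\|\cdot\|_E/R_{p-1}$, whose dual norm is $R_{p-1}\|\cdot\|_{E,*}$), and $\Theta_0^2=\frac{\Omega}{2}$; set $d_p(x)=d\big(\frac{x-x_p}{R_p}\big)$. Stop after the first stage $p$ with $p\ge\log_2\frac{\mu R_0^2}{2\varepsilon}$ and return $x_p$.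
   Formalization: d is assumed a prox-function, with the bound Ω/2, on X and on all sets (X−z)/R, z∈X, 0<R≤R₀; termination and the iteration bound assume the chosen subgradients at boundary points of X have dual norm ≤ M_f, M_g; the iteration bound is for 2ε<μR₀² only. *)

theory Defs
  imports "HOL-Analysis.Analysis"
begin

text \<open>
  The space \<open>E\<close> is a type of class \<open>euclidean_space\<close>. Its inner product plays no role: distances are
  measured by an arbitrary norm \<open>N\<close>, and \<open>E\<^sup>*\<close> is the type of (bounded) linear functionals.
\<close>

definition is_norm :: "('a::real_vector \<Rightarrow> real) \<Rightarrow> bool" where
  "is_norm N \<longleftrightarrow>
     (\<forall>x. N x = 0 \<longleftrightarrow> x = 0) \<and>
     (\<forall>c x. N (c *\<^sub>R x) = \<bar>c\<bar> * N x) \<and>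
     (\<forall>x y. N (x + y) \<le> N x + N y)"

definition dual_norm :: "('a::real_normed_vector \<Rightarrow> real) \<Rightarrow> ('a \<Rightarrow>\<^sub>L real) \<Rightarrow> real" where
  "dual_norm N p = (SUP x\<in>{x. N x \<le> 1}. p x)"

definition subgradient ::
  "'a::real_normed_vector set \<Rightarrow> ('a \<Rightarrow> real) \<Rightarrow> 'a \<Rightarrow> ('a \<Rightarrow>\<^sub>L real) \<Rightarrow> bool" where
  "subgradient S f x p \<longleftrightarrow> x \<in> S \<and> (\<forall>y\<in>S. f x + p (y - x) \<le> f y)"

text \<open>Here \<open>D\<close> is the domain of \<open>f\<close>; the inequality is required on \<open>X \<subseteq> D\<close> only.\<close>

definition strongly_convex ::
  "('a::real_normed_vector \<Rightarrow> real) \<Rightarrow> real \<Rightarrow> 'a set \<Rightarrow> 'a set \<Rightarrow> ('a \<Rightarrow> real) \<Rightarrow> bool" where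
  "strongly_convex N \<mu> D X f \<longleftrightarrow>
     (\<forall>x\<in>X. \<forall>y\<in>X. \<forall>p. subgradient D f x p \<longrightarrow>
        f x + p (y - x) + \<mu> / 2 * (N (y - x))\<^sup>2 \<le> f y)"

definition lipschitz_wrt ::
  "('a::real_normed_vector \<Rightarrow> real) \<Rightarrow> real \<Rightarrow> 'a set \<Rightarrow> ('a \<Rightarrow> real) \<Rightarrow> bool" where
  "lipschitz_wrt N M X f \<longleftrightarrow> (\<forall>x\<in>X. \<forall>y\<in>X. \<bar>f x - f y\<bar> \<le> M * N (x - y))"

text \<open>A prox-function \<open>d\<close> on \<open>S\<close> with continuous selection \<open>gd\<close> of subgradients on \<open>S\<^sup>0\<close>.\<close>

definition prox_function ::
  "('a::real_normed_vector \<Rightarrow> real) \<Rightarrow> 'a set \<Rightarrow> ('a \<Rightarrow> real) \<Rightarrow> ('a \<Rightarrow> ('a \<Rightarrow>\<^sub>L real)) \<Rightarrow> bool" where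
  "prox_function N S d gd \<longleftrightarrow>
     (let S\<^sub>0 = {x \<in> S. \<exists>p. subgradient S d x p} in
        continuous_on S d \<and> convex_on S d \<and>
        continuous_on S\<^sub>0 gd \<and> (\<forall>x\<in>S\<^sub>0. subgradient S d x (gd x)) \<and>
        (\<forall>x\<in>S\<^sub>0. \<forall>y\<in>S. d y - d x - gd x (y - x) \<ge> 1 / 2 * (N (y - x))\<^sup>2) \<and>
        is_arg_min d (\<lambda>x. x \<in> S) 0 \<and> d 0 = 0)"

text \<open>
  The restarts evaluate \<open>d\<close> at the points \<open>(x - z) / R\<close> with \<open>x, z \<in> X\<close> and \<open>0 < R \<le> R\<^sub>0\<close>, which in
  general lie outside \<open>X\<close>. The properties of \<open>d\<close> are needed on each of the following sets.
\<close>

definition prox_domains :: "'a::real_normed_vector set \<Rightarrow> real \<Rightarrow> 'a set set" where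
  "prox_domains X R\<^sub>0 = insert X {(\<lambda>x. (x - z) /\<^sub>R R) ` X | z R. z \<in> X \<and> 0 < R \<and> R \<le> R\<^sub>0}"


subsection \<open>Adaptive Mirror Descent\<close>

text \<open>\<open>inner_theta2\<close> is the number \<open>\<Theta>\<^sub>0\<^sup>2\<close>.\<close>

record (overloaded) ('a::real_normed_vector) amd_input =
  feasible :: "'a set"
  constraint :: "'a \<Rightarrow> real"
  obj_subgrad :: "'a \<Rightarrow> ('a \<Rightarrow>\<^sub>L real)"
  constr_subgrad :: "'a \<Rightarrow> ('a \<Rightarrow>\<^sub>L real)"
  inner_norm :: "'a \<Rightarrow> real"
  inner_prox :: "'a \<Rightarrow> real"
  inner_prox_grad :: "'a \<Rightarrow> ('a \<Rightarrow>\<^sub>L real)"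
  inner_accuracy :: real
  inner_theta2 :: real

definition mirr :: "'a::real_normed_vector amd_input \<Rightarrow> 'a \<Rightarrow> ('a \<Rightarrow>\<^sub>L real) \<Rightarrow> 'a" where
  "mirr A x p = arg_min_on (\<lambda>u. p u + inner_prox A u - inner_prox_grad A x u) (feasible A)"

definition productive :: "'a::real_normed_vector amd_input \<Rightarrow> 'a \<Rightarrow> bool" where
  "productive A x \<longleftrightarrow> constraint A x \<le> inner_accuracy A"

definition step_subgrad :: "'a::real_normed_vector amd_input \<Rightarrow> 'a \<Rightarrow> ('a \<Rightarrow>\<^sub>L real)" where
  "step_subgrad A x = (if productive A x then obj_subgrad A x else constr_subgrad A x)"

definition step_M :: "'a::real_normed_vector amd_input \<Rightarrow> 'a \<Rightarrow> real" where
  "step_M A x = dual_norm (inner_norm A) (step_subgrad A x)"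

definition step_size :: "'a::real_normed_vector amd_input \<Rightarrow> 'a \<Rightarrow> real" where
  "step_size A x = inner_accuracy A / (step_M A x)\<^sup>2"

primrec amd_iterate :: "'a::real_normed_vector amd_input \<Rightarrow> nat \<Rightarrow> 'a" where
  "amd_iterate A 0 = arg_min_on (inner_prox A) (feasible A)"
| "amd_iterate A (Suc k) =
     mirr A (amd_iterate A k)
       (step_size A (amd_iterate A k) *\<^sub>R step_subgrad A (amd_iterate A k))"

text \<open>
  A vanishing \<open>M\<^sub>j\<close> counts as \<open>M\<^sub>j\<^sup>-\<^sup>2 = \<infinity>\<close> (whereas \<open>1 / 0 = 0\<close> in HOL), so that the criterion holds
  right after step \<open>j\<close>. As \<open>h\<^sub>j = \<infinity>\<close> then, the weighted average degenerates to the point \<open>x\<^sup>j\<close>.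
\<close>

definition amd_stop :: "'a::real_normed_vector amd_input \<Rightarrow> nat \<Rightarrow> bool" where
  "amd_stop A k \<longleftrightarrow>
     (\<exists>j<k. step_M A (amd_iterate A j) = 0) \<or>
     (\<Sum>j<k. 1 / (step_M A (amd_iterate A j))\<^sup>2) \<ge> 2 * inner_theta2 A / (inner_accuracy A)\<^sup>2"

definition amd_terminates :: "'a::real_normed_vector amd_input \<Rightarrow> bool" where
  "amd_terminates A \<longleftrightarrow> (\<exists>k\<ge>1. amd_stop A k)"

definition amd_iterations :: "'a::real_normed_vector amd_input \<Rightarrow> nat" where
  "amd_iterations A = (LEAST k. k \<ge> 1 \<and> amd_stop A k)"

definition amd_output :: "'a::real_normed_vector amd_input \<Rightarrow> 'a" where
  "amd_output A =
     (let n = amd_iterations A;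
          x = amd_iterate A;
          I = {i. i < n \<and> productive A (x i)}
      in if step_M A (x (n - 1)) = 0 then x (n - 1)
         else (\<Sum>i\<in>I. step_size A (x i) *\<^sub>R x i) /\<^sub>R (\<Sum>i\<in>I. step_size A (x i)))"


subsection \<open>Restarts\<close>

definition restart_radius :: "real \<Rightarrow> nat \<Rightarrow> real" where
  "restart_radius R\<^sub>0 p = sqrt (R\<^sub>0\<^sup>2 / 2 ^ p)"

definition restart_accuracy :: "real \<Rightarrow> real \<Rightarrow> nat \<Rightarrow> real" where
  "restart_accuracy \<mu> R\<^sub>0 p = \<mu> * (restart_radius R\<^sub>0 p)\<^sup>2 / 2"

text \<open>
  \<open>stage_input \<dots> c p\<close> is the input of stage \<open>p + 1\<close> when the current centre \<open>x\<^sub>p\<close> is \<open>c\<close>. The subgradients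
  of the rescaled prox-function are those of \<open>d\<close> transformed by the chain rule.
\<close>

definition stage_input ::
  "'a::real_normed_vector set \<Rightarrow> ('a \<Rightarrow> real) \<Rightarrow> ('a \<Rightarrow> ('a \<Rightarrow>\<^sub>L real)) \<Rightarrow> ('a \<Rightarrow> ('a \<Rightarrow>\<^sub>L real)) \<Rightarrow>
   ('a \<Rightarrow> real) \<Rightarrow> ('a \<Rightarrow> real) \<Rightarrow> ('a \<Rightarrow> ('a \<Rightarrow>\<^sub>L real)) \<Rightarrow> real \<Rightarrow> real \<Rightarrow> real \<Rightarrow>
   'a \<Rightarrow> nat \<Rightarrow> 'a amd_input" where
  "stage_input X g gf gg N d gd \<mu> \<Omega> R\<^sub>0 c p =
     (let R = restart_radius R\<^sub>0 p in
      \<lparr> feasible = X,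
        constraint = g,
        obj_subgrad = gf,
        constr_subgrad = gg,
        inner_norm = (\<lambda>u. N u / R),
        inner_prox = (\<lambda>u. d ((u - c) /\<^sub>R R)),
        inner_prox_grad = (\<lambda>u. gd ((u - c) /\<^sub>R R) /\<^sub>R R),
        inner_accuracy = restart_accuracy \<mu> R\<^sub>0 (Suc p),
        inner_theta2 = \<Omega> / 2 \<rparr>)"

primrec restart_point :: "('a \<Rightarrow> nat \<Rightarrow> 'a::real_normed_vector amd_input) \<Rightarrow> 'a \<Rightarrow> nat \<Rightarrow> 'a" where
  "restart_point G x\<^sub>0 0 = x\<^sub>0"
| "restart_point G x\<^sub>0 (Suc p) = amd_output (G (restart_point G x\<^sub>0 p) p)"

text \<open>The index of the last stage; the test comes after a stage, so at least one stage is run.\<close>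

definition restart_stages :: "real \<Rightarrow> real \<Rightarrow> real \<Rightarrow> nat" where
  "restart_stages \<mu> R\<^sub>0 \<epsilon> = (LEAST p. p \<ge> 1 \<and> real p \<ge> log 2 (\<mu> * R\<^sub>0\<^sup>2 / (2 * \<epsilon>)))"

definition restart_terminates ::
  "('a \<Rightarrow> nat \<Rightarrow> 'a::real_normed_vector amd_input) \<Rightarrow> 'a \<Rightarrow> nat \<Rightarrow> bool" where
  "restart_terminates G x\<^sub>0 P \<longleftrightarrow> (\<forall>p<P. amd_terminates (G (restart_point G x\<^sub>0 p) p))"

definition restart_iterations ::
  "('a \<Rightarrow> nat \<Rightarrow> 'a::real_normed_vector amd_input) \<Rightarrow> 'a \<Rightarrow> nat \<Rightarrow> nat" where
  "restart_iterations G x\<^sub>0 P = (\<Sum>p<P. amd_iterations (G (restart_point G x\<^sub>0 p) p))"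

end

theory Submission
  imports Defs
begin

text \<open>
  The proof runs one induction over the stages: the centre \<open>x\<^sub>p\<close> stays within \<open>R\<^sub>p\<close> of the solution.

  If it does, the rescaled prox-function is at most \<open>\<Omega> / 2\<close> at the solution (\<open>stage\<close>), which is the
  hypothesis under which a run of Adaptive Mirror Descent with \<open>\<Theta>\<^sub>0\<^sup>2 = \<Omega> / 2\<close> returns a point with
  \<open>f - f xstar \<le> \<epsilon>\<^sub>p\<^sub>+\<^sub>1\<close> and \<open>g \<le> \<epsilon>\<^sub>p\<^sub>+\<^sub>1\<close> (\<open>output_accuracy\<close>). Since \<open>f\<close> and \<open>g\<close> are strongly convex,
  \<open>\<mu>/2 (N (x - xstar))\<^sup>2 \<le> max (f x - f xstar) (g x)\<close> on \<open>X\<close> (\<open>quadratic_growth\<close>), and \<open>\<epsilon>\<^sub>p\<^sub>+\<^sub>1 = \<mu> R\<^sub>p\<^sub>+\<^sub>1\<^sup>2 / 2\<close> is chosen such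
  that this is the induction hypothesis for the next stage.

  The run itself is analysed by summing the mirror steps. Each step of weight \<open>h\<close> reduces the Bregman distance to the
  solution by \<open>h\<close> times the gap in \<open>f\<close> or \<open>g\<close>, up to the error \<open>h \<delta> / 2\<close> (\<open>progress\<close>); when the run stops, the
  initial Bregman distance is at most \<open>\<delta> / 2\<close> times the total weight. Hence the weighted mean of the gaps is at most \<open>\<delta>\<close>,
  while steps that are not productive have gaps above \<open>\<delta>\<close>, so the mean over the productive steps is at most \<open>\<delta>\<close>.

  The delicate point is the mirror step at the boundary of \<open>X\<close>, where the chosen subgradient of the prox-function need not be
  the one that certifies minimality. The variational inequality for the chosen one follows from the
  continuity of the selection and the density of the points of subdifferentiability (\<open>minimal_first_order\<close>).

  For the complexity, stage \<open>p + 1\<close> takes at most \<open>1 + 16 \<Omega> M\<^sup>2 2\<^sup>p / (\<mu>\<^sup>2 R\<^sub>0\<^sup>2)\<close> iterations (\<open>stage_iterations\<close>),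
  where \<open>M\<^sup>2 = max (M\<^sub>f\<^sup>2) (M\<^sub>g\<^sup>2)\<close>.
  This is a geometric series in \<open>p\<close>, and at the last stage \<open>2\<^sup>P \<le> \<mu> R\<^sub>0\<^sup>2 / \<epsilon>\<close> when
  \<open>2 \<epsilon> < \<mu> R\<^sub>0\<^sup>2\<close>.
\<close>

section \<open>Norms and dual norms\<close>

lemma is_norm_zero: "is_norm N \<Longrightarrow> N 0 = 0"
  by (simp add: is_norm_def)

lemma is_norm_minus: "is_norm N \<Longrightarrow> N (- x) = N x"
  unfolding is_norm_def by (metis abs_1 abs_minus mult_1 scaleR_minus1_left)

lemma is_norm_minus_commute: "is_norm N \<Longrightarrow> N (x - y) = N (y - x)"
  by (metis is_norm_minus minus_diff_eq)

lemma is_norm_nonneg: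
  assumes "is_norm N" shows "0 \<le> N x"
proof -
  have "N (x + - x) \<le> N x + N (- x)" using assms unfolding is_norm_def by blast
  then show ?thesis using is_norm_minus[OF assms] is_norm_zero[OF assms] by simp
qed

lemma is_norm_divide: "is_norm N \<Longrightarrow> R > 0 \<Longrightarrow> is_norm (\<lambda>u. N u / R)"
  unfolding is_norm_def by (auto simp: field_simps)

text \<open>
  Finite dimension enters here: \<open>N\<close> is convex, hence continuous, so it has a positive minimum on the
  compact Euclidean unit sphere. This makes the supremum in \<open>dual_norm\<close> finite and quadratic
  growth in \<open>N\<close> coercive.
\<close>

lemma is_norm_ge_norm:
  fixes N :: "'a::euclidean_space \<Rightarrow> real"
  assumes "is_norm N"
  obtains \<kappa> where "\<kappa> > 0" "\<And>x. \<kappa> * norm x \<le> N x"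
proof -
  have "convex_on UNIV N"
  proof (rule convex_onI)
    fix t :: real and x y assume t: "0 < t" "t < 1"
    have "N ((1 - t) *\<^sub>R x + t *\<^sub>R y) \<le> N ((1 - t) *\<^sub>R x) + N (t *\<^sub>R y)"
      using assms unfolding is_norm_def by blast
    then show "N ((1 - t) *\<^sub>R x + t *\<^sub>R y) \<le> (1 - t) * N x + t * N y"
      using assms t unfolding is_norm_def by simp
  qed simp
  then have cont: "continuous_on UNIV N" by (rule convex_on_continuous[OF open_UNIV])
  obtain b :: 'a where b: "b \<in> Basis" using nonempty_Basis by blast
  have "sphere 0 1 \<noteq> ({} :: 'a set)" using b by (auto intro!: exI[of _ b])
  then obtain s where s: "norm s = 1" "\<And>x. norm x = 1 \<Longrightarrow> N s \<le> N x"
    using continuous_attains_inf[OF compact_sphere, of "0::'a" 1 N] continuous_on_subset[OF cont subset_UNIV]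
    by auto
  show thesis
  proof
    have "s \<noteq> 0" using s by auto
    then show "N s > 0" using is_norm_nonneg[OF assms, of s] assms unfolding is_norm_def
      by (metis less_eq_real_def)
    fix x show "N s * norm x \<le> N x"
    proof (cases "x = 0")
      case False
      have "N s \<le> N (inverse (norm x) *\<^sub>R x)" using False by (intro s(2)) simp
      also have "\<dots> = N x / norm x" using assms unfolding is_norm_def by (simp add: divide_inverse mult.commute)
      finally show ?thesis using False by (simp add: field_simps)
    qed (use is_norm_zero[OF assms] in simp)
  qed
qed

lemma dual_norm_bdd_above:
  fixes N :: "'a::euclidean_space \<Rightarrow> real" and p :: "'a \<Rightarrow>\<^sub>L real"
  assumes "is_norm N"
  shows "bdd_above (p ` {x. N x \<le> 1})"
proof -
  obtain \<kappa> where \<kappa>: "\<kappa> > 0" "\<And>x. \<kappa> * norm x \<le> N x" using is_norm_ge_norm[OF assms] by blast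
  have "p x \<le> norm p * (1 / \<kappa>)" if "N x \<le> 1" for x
  proof -
    have "p x \<le> norm p * norm x" using norm_blinfun[of p x] by simp
    also have "norm x \<le> 1 / \<kappa>" using \<kappa>(2)[of x] that \<kappa>(1) by (simp add: field_simps)
    finally show ?thesis by (simp add: mult_left_mono)
  qed
  then show ?thesis by (intro bdd_aboveI2) auto
qed

lemma dual_norm_nonneg:
  fixes N :: "'a::euclidean_space \<Rightarrow> real"
  assumes "is_norm N" shows "0 \<le> dual_norm N p"
proof -
  have "p 0 \<le> dual_norm N p" unfolding dual_norm_def
    by (rule cSUP_upper[OF _ dual_norm_bdd_above[OF assms]]) (simp add: is_norm_zero[OF assms])
  then show ?thesis by simp
qed

lemma le_dual_norm_mult:
  fixes N :: "'a::euclidean_space \<Rightarrow> real" and p :: "'a \<Rightarrow>\<^sub>L real"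
  assumes "is_norm N" shows "p x \<le> dual_norm N p * N x"
proof (cases "x = 0")
  case False
  then have pos: "N x > 0" using is_norm_nonneg[OF assms, of x] assms unfolding is_norm_def
    by (metis less_eq_real_def)
  have "p (inverse (N x) *\<^sub>R x) \<le> dual_norm N p" unfolding dual_norm_def
    by (rule cSUP_upper[OF _ dual_norm_bdd_above[OF assms]])
      (use assms pos in \<open>auto simp: is_norm_def\<close>)
  then show ?thesis using pos by (simp add: blinfun.scaleR_right field_simps)
qed (simp add: is_norm_zero[OF assms])

lemma dual_norm_le:
  fixes p :: "'a::real_normed_vector \<Rightarrow>\<^sub>L real"
  assumes "is_norm N" "0 \<le> M" "\<And>u. p u \<le> M * N u"
  shows "dual_norm N p \<le> M"
  unfolding dual_norm_def
proof (rule cSUP_least)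
  show "{x. N x \<le> 1} \<noteq> {}" using is_norm_zero[OF assms(1)] by (auto intro!: exI[of _ 0])
  fix x assume "x \<in> {x. N x \<le> 1}"
  then have "M * N x \<le> M * 1" using assms(2) by (intro mult_left_mono) auto
  then show "p x \<le> M" using assms(3)[of x] by simp
qed

lemma dual_norm_eq_0:
  fixes N :: "'a::euclidean_space \<Rightarrow> real"
  assumes "is_norm N" "dual_norm N p = 0" shows "p = 0"
proof (rule blinfun_eqI)
  fix x have "p x \<le> 0" "p (- x) \<le> 0"
    using le_dual_norm_mult[OF assms(1), of p x] le_dual_norm_mult[OF assms(1), of p "- x"] assms(2) by auto
  then show "p x = (0 :: 'a \<Rightarrow>\<^sub>L real) x" by (simp add: blinfun.minus_right)
qed

lemma dual_norm_divide_le: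
  fixes N :: "'a::euclidean_space \<Rightarrow> real"
  assumes "is_norm N" "R > 0"
  shows "dual_norm (\<lambda>u. N u / R) p \<le> R * dual_norm N p"
  by (rule dual_norm_le[OF is_norm_divide[OF assms]])
    (use assms dual_norm_nonneg[OF assms(1)] le_dual_norm_mult[OF assms(1)] in auto)

text \<open>
  The subgradient inequality can be tested along every direction at an interior point, which turns the
  Lipschitz bound on \<open>\<phi>\<close> into a bound on each \<open>p u\<close>. At a boundary point an outward normal can be added to a
  subgradient, so that no such bound holds for all subgradients there.
\<close>

lemma dual_norm_subgradient_le_lipschitz:
  fixes N :: "'a::euclidean_space \<Rightarrow> real" and p :: "'a \<Rightarrow>\<^sub>L real"
  assumes "is_norm N" "lipschitz_wrt N M X \<phi>" "subgradient X \<phi> x p" "x \<in> interior X"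
  shows "dual_norm N p \<le> M"
proof -
  obtain e where e: "e > 0" "ball x e \<subseteq> X" using assms(4) by (auto simp: mem_interior)
  have le: "p u \<le> M * N u" for u
  proof -
    define t where "t = e / (2 * (norm u + 1))"
    have t: "t > 0" unfolding t_def using e(1) by (simp add: add_nonneg_pos)
    have "t * norm u < e"
    proof -
      have "t * (norm u + 1) = e / 2" unfolding t_def by (simp add: field_simps add_nonneg_eq_0_iff)
      moreover have "t * norm u \<le> t * (norm u + 1)" using t by simp
      ultimately show ?thesis using e(1) by linarith
    qed
    then have y: "x + t *\<^sub>R u \<in> X" using e(2) t by (auto simp: subset_iff dist_norm)
    have x: "x \<in> X" using assms(3) by (simp add: subgradient_def)
    have "t * p u \<le> \<phi> (x + t *\<^sub>R u) - \<phi> x"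
      using assms(3) y unfolding subgradient_def by (force simp: blinfun.scaleR_right)
    also have "\<dots> \<le> M * N (t *\<^sub>R u)" using assms(2) x y unfolding lipschitz_wrt_def
      by (metis abs_ge_self add_diff_cancel_left' order_trans)
    also have "\<dots> = t * (M * N u)" using assms(1) t unfolding is_norm_def by simp
    finally show ?thesis using t by simp
  qed
  obtain b :: 'a where b: "b \<in> Basis" using nonempty_Basis by blast
  have "N b > 0" using b is_norm_nonneg[OF assms(1), of b] assms(1) unfolding is_norm_def
    by (metis less_eq_real_def nonzero_Basis)
  moreover have "0 \<le> M * N b" using le[of b] le[of "- b"] is_norm_minus[OF assms(1)]
    by (simp add: blinfun.minus_right)
  ultimately have "0 \<le> M" by (simp add: zero_le_mult_iff)
  then show ?thesis using dual_norm_le[OF assms(1)] le by blast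
qed

section \<open>Existence of minimisers\<close>

lemma attains_min_if_sublevel_bounded:
  fixes \<phi> :: "'a::euclidean_space \<Rightarrow> real"
  assumes "closed X" "continuous_on X \<phi>" "a \<in> X"
    and bound: "\<And>u. u \<in> X \<Longrightarrow> \<phi> u \<le> \<phi> a \<Longrightarrow> norm (u - a) \<le> r"
  obtains u where "is_arg_min \<phi> (\<lambda>x. x \<in> X) u"
proof -
  let ?K = "X \<inter> cball a (max r 0)"
  have "compact ?K" using assms(1) by (simp add: closed_Int_compact)
  moreover have "a \<in> ?K" using assms(3) by simp
  moreover have "continuous_on ?K \<phi>" using assms(2) continuous_on_subset by blast
  ultimately obtain u where u: "u \<in> ?K" "\<And>y. y \<in> ?K \<Longrightarrow> \<phi> u \<le> \<phi> y"
    using continuous_attains_inf[of ?K \<phi>] by blast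
  have "\<phi> u \<le> \<phi> y" if "y \<in> X" for y
  proof (cases "\<phi> y \<le> \<phi> a")
    case True
    then show ?thesis using bound[OF that True] that u(2)[of y] by (auto simp: dist_norm norm_minus_commute)
  next
    case False
    then show ?thesis using u(2)[OF \<open>a \<in> ?K\<close>] by simp
  qed
  then show thesis using u(1) by (intro that[of u]) (auto simp: is_arg_min_linorder)
qed

lemma is_arg_min_arg_min_on:
  assumes "is_arg_min \<phi> (\<lambda>x. x \<in> X) u"
  shows "is_arg_min \<phi> (\<lambda>x. x \<in> X) (arg_min_on \<phi> X)"
  unfolding arg_min_on_def arg_min_def by (rule someI[of "is_arg_min \<phi> (\<lambda>x. x \<in> X)", OF assms])

section \<open>Prox-functions and mirror steps\<close>

text \<open>
  A prox-function whose minimiser may lie anywhere in the feasible set. In this form the notion is stable under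
  the translations and dilations of the restarts.
\<close>

locale distance_generating =
  fixes N :: "'a::euclidean_space \<Rightarrow> real" and X :: "'a set"
    and d :: "'a \<Rightarrow> real" and gd :: "'a \<Rightarrow> ('a \<Rightarrow>\<^sub>L real)"
  assumes norm: "is_norm N"
    and closed: "closed X" and convex: "convex X"
    and d_cont: "continuous_on X d" and d_convex: "convex_on X d"
    and d_min: "\<exists>c. is_arg_min d (\<lambda>x. x \<in> X) c"
    and gd_cont: "continuous_on {x \<in> X. \<exists>p. subgradient X d x p} gd"
    and gd_strong: "\<And>x y p. subgradient X d x p \<Longrightarrow> y \<in> X \<Longrightarrow>
      d x + gd x (y - x) + 1 / 2 * (N (y - x))\<^sup>2 \<le> d y"
begin

definition subdiff_domain :: "'a set" where
  "subdiff_domain = {x \<in> X. \<exists>p. subgradient X d x p}"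

definition bregman :: "'a \<Rightarrow> 'a \<Rightarrow> real" where
  "bregman x y = d y - d x - gd x (y - x)"

lemma bregman_ge:
  assumes "x \<in> subdiff_domain" "y \<in> X"
  shows "1 / 2 * (N (y - x))\<^sup>2 \<le> bregman x y"
  using assms gd_strong unfolding subdiff_domain_def bregman_def by fastforce

lemma gd_lower:
  assumes "x \<in> subdiff_domain" "y \<in> X"
  shows "d x + gd x (y - x) \<le> d y"
  using bregman_ge[OF assms] zero_le_power2[of "N (y - x)"] unfolding bregman_def by linarith

lemma subgradient_if_minimal:
  fixes q :: "'a \<Rightarrow>\<^sub>L real"
  assumes "is_arg_min (\<lambda>u. q u + d u) (\<lambda>x. x \<in> X) u"
  shows "subgradient X d u (- q)"
  using assms by (force simp: subgradient_def is_arg_min_linorder blinfun.minus_left blinfun.diff_right)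

text \<open>
  Strong convexity at the minimiser \<open>c\<close> of \<open>d\<close> bounds \<open>d\<close> below by a quadratic in \<open>u - c\<close>, which dominates
  every linear functional. Hence each prox-mapping of the method is defined.
\<close>

lemma linear_perturbation_has_min:
  fixes q :: "'a \<Rightarrow>\<^sub>L real"
  obtains u where "is_arg_min (\<lambda>u. q u + d u) (\<lambda>x. x \<in> X) u"
proof -
  obtain c where c: "is_arg_min d (\<lambda>x. x \<in> X) c" using d_min by blast
  then have cX: "c \<in> X" by (simp add: is_arg_min_def)
  have c0: "c \<in> subdiff_domain"
    using subgradient_if_minimal[of 0 c] c cX unfolding subdiff_domain_def by auto
  obtain \<kappa> where \<kappa>: "\<kappa> > 0" "\<And>x. \<kappa> * norm x \<le> N x" using is_norm_ge_norm[OF norm] by blast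
  define K where "K = norm (q + gd c)"
  show thesis
  proof (rule attains_min_if_sublevel_bounded[OF closed _ cX])
    show "continuous_on X (\<lambda>u. q u + d u)"
      by (intro continuous_intros d_cont)
    fix u assume u: "u \<in> X" "q u + d u \<le> q c + d c"
    let ?r = "norm (u - c)"
    have "1 / 2 * (\<kappa> * ?r)\<^sup>2 \<le> 1 / 2 * (N (u - c))\<^sup>2"
      using \<kappa> by (intro mult_left_mono power_mono) auto
    also have "\<dots> \<le> d u - d c - gd c (u - c)" using bregman_ge[OF c0 u(1)] by (simp add: bregman_def)
    also have "\<dots> \<le> - (q + gd c) (u - c)" using u(2) by (simp add: blinfun.add_left blinfun.diff_right blinfun.minus_left)
    also have "\<dots> \<le> K * ?r" using norm_blinfun[of "q + gd c" "u - c"] unfolding K_def real_norm_def by linarith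
    finally have "?r * (\<kappa>\<^sup>2 * ?r) \<le> ?r * (2 * K)" by (simp add: power2_eq_square algebra_simps)
    then have "?r = 0 \<or> \<kappa>\<^sup>2 * ?r \<le> 2 * K" by (smt (verit) mult_le_cancel_left norm_ge_zero)
    then show "?r \<le> 2 * K / \<kappa>\<^sup>2" using \<kappa>(1) by (auto simp: field_simps K_def)
  qed (use that in blast)
qed

text \<open>
  Minimise \<open>d u + \<tau> \<parallel>u - w\<parallel>\<^sup>2\<close>: as \<open>d\<close> is bounded below, the minimiser is close to \<open>w\<close> for large \<open>\<tau>\<close>, and
  the negative gradient of the quadratic term is a subgradient of \<open>d\<close> there.
\<close>

lemma subdiff_domain_dense:
  assumes "w \<in> X" "e > 0"
  obtains u where "u \<in> subdiff_domain" "norm (u - w) \<le> e"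
proof -
  obtain c where c: "is_arg_min d (\<lambda>x. x \<in> X) c" using d_min by blast
  then have dc: "d c \<le> d y" if "y \<in> X" for y using that by (auto simp: is_arg_min_linorder)
  define C where "C = d w - d c + 1"
  have C: "C > 0" using dc[OF assms(1)] unfolding C_def by simp
  define \<tau> where "\<tau> = C / e\<^sup>2"
  have \<tau>: "\<tau> > 0" using C assms(2) unfolding \<tau>_def by simp
  let ?\<phi> = "\<lambda>u. d u + \<tau> * (norm (u - w))\<^sup>2"
  have near: "norm (u - w) \<le> e" if "u \<in> X" "?\<phi> u \<le> ?\<phi> w" for u
  proof -
    have "\<tau> * (norm (u - w))\<^sup>2 \<le> C" using that dc[OF that(1)] unfolding C_def by simp
    also have "C = \<tau> * e\<^sup>2" using assms(2) unfolding \<tau>_def by simp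
    finally have "(norm (u - w))\<^sup>2 \<le> e\<^sup>2" using \<tau> by simp
    then show ?thesis using assms(2) power2_le_imp_le by fastforce
  qed
  have "continuous_on X ?\<phi>" by (intro continuous_intros d_cont)
  then obtain u where u: "is_arg_min ?\<phi> (\<lambda>x. x \<in> X) u"
    using attains_min_if_sublevel_bounded[of X ?\<phi> w e] closed assms(1) near by blast
  have uX: "u \<in> X" using u by (simp add: is_arg_min_def)
  have umin: "?\<phi> u \<le> ?\<phi> y" if "y \<in> X" for y using u that by (auto simp: is_arg_min_linorder)
  define p where "p = (2 * \<tau>) *\<^sub>R blinfun_inner_left (w - u)"
  have "d u + p (y - u) \<le> d y" if y: "y \<in> X" for y
  proof -
    have ineq: "p (y - u) - t * (\<tau> * (norm (y - u))\<^sup>2) \<le> d y - d u" if t: "0 < t" "t < 1" for t :: real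
    proof -
      let ?z = "(1 - t) *\<^sub>R u + t *\<^sub>R y"
      have z: "?z \<in> X" using convex uX y t by (simp add: convex_def)
      define i where "i = (w - u) \<bullet> (y - u)"
      define r where "r = (norm (y - u))\<^sup>2"
      define s where "s = (norm (u - w))\<^sup>2"
      have "d ?z \<le> (1 - t) * d u + t * d y" using d_convex t uX y by (intro convex_onD) auto
      then have "d ?z \<le> d u + t * (d y - d u)" by (simp add: algebra_simps)
      moreover have "(norm (?z - w))\<^sup>2 = s - 2 * t * i + t\<^sup>2 * r"
      proof -
        have "?z - w = (u - w) + t *\<^sub>R (y - u)" by (simp add: algebra_simps)
        then show ?thesis unfolding i_def r_def s_def
          by (simp add: power2_norm_eq_inner inner_add_left inner_add_right)
            (simp add: inner_diff_left inner_diff_right inner_commute power2_eq_square algebra_simps)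
      qed
      then have "d u + \<tau> * s \<le> d ?z + \<tau> * (s - 2 * t * i + t\<^sup>2 * r)" using umin[OF z] unfolding s_def by simp
      moreover have "\<tau> * (s - 2 * t * i + t\<^sup>2 * r) = \<tau> * s - t * (2 * \<tau> * i - t * (\<tau> * r))"
        by (simp add: algebra_simps power2_eq_square)
      ultimately have "t * (2 * \<tau> * i - t * (\<tau> * r)) \<le> t * (d y - d u)" by linarith
      then have "t * (p (y - u) - t * (\<tau> * (norm (y - u))\<^sup>2)) \<le> t * (d y - d u)"
        unfolding p_def i_def r_def by (simp add: blinfun.scaleR_left inner_commute)
      then show ?thesis using t by simp
    qed
    have "p (y - u) \<le> d y - d u"
    proof (rule tendsto_upperbound)
      show "((\<lambda>t. p (y - u) - t * (\<tau> * (norm (y - u))\<^sup>2)) \<longlongrightarrow> p (y - u)) (at_right 0)"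
        by (auto intro!: tendsto_eq_intros)
      show "\<forall>\<^sub>F t in at_right 0. p (y - u) - t * (\<tau> * (norm (y - u))\<^sup>2) \<le> d y - d u"
        using eventually_at_right_less[of 0] eventually_at_right_real[OF zero_less_one]
        by eventually_elim (use ineq in auto)
    qed simp
    then show ?thesis by simp
  qed
  then have "u \<in> subdiff_domain" using uX unfolding subdiff_domain_def subgradient_def by blast
  then show thesis using that near[OF uX umin[OF assms(1)]] by blast
qed

text \<open>
  Minimality of \<open>u\<close> only says that \<open>- q\<close> is some subgradient of \<open>d\<close> at \<open>u\<close>. On the boundary \<open>gd u\<close> may be
  another one, and the variational inequality for \<open>gd u\<close> depends on the continuity of the selection:
  for subdifferentiable points \<open>v\<close> near \<open>u\<close>, convexity and minimality give \<open>(q + gd v) (v - u) \<ge> 0\<close>. Density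
  lets \<open>v\<close> tend to \<open>u\<close> in the direction \<open>y - u\<close>, and the inequality passes to the limit.
\<close>

lemma minimal_first_order:
  fixes q :: "'a \<Rightarrow>\<^sub>L real"
  assumes u: "is_arg_min (\<lambda>u. q u + d u) (\<lambda>x. x \<in> X) u"
  shows "u \<in> subdiff_domain" and "y \<in> X \<Longrightarrow> 0 \<le> q (y - u) + gd u (y - u)"
proof -
  have uX: "u \<in> X" using u by (simp add: is_arg_min_def)
  show u0: "u \<in> subdiff_domain" using subgradient_if_minimal[OF u] uX unfolding subdiff_domain_def by blast
  assume y: "y \<in> X"
  define t where "t n = 1 / real (Suc n)" for n
  have t: "0 < t n" "t n \<le> 1" for n unfolding t_def by simp_all
  \<comment> \<open>The tolerance is of second order in \<open>t n\<close>, so that the direction of \<open>v - u\<close> still tends to \<open>y - u\<close>.\<close>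
  have "\<exists>v. v \<in> subdiff_domain \<and> norm (v - ((1 - t n) *\<^sub>R u + t n *\<^sub>R y)) \<le> (t n)\<^sup>2" for n
  proof -
    have "(1 - t n) *\<^sub>R u + t n *\<^sub>R y \<in> X" using convex uX y t[of n] by (simp add: convex_def)
    then show ?thesis using subdiff_domain_dense t(1)[of n] by (metis zero_less_power)
  qed
  then obtain v where v: "v n \<in> subdiff_domain" "norm (v n - ((1 - t n) *\<^sub>R u + t n *\<^sub>R y)) \<le> (t n)\<^sup>2" for n
    by metis
  define w where "w n = (v n - u) /\<^sub>R t n" for n
  have w: "v n = u + t n *\<^sub>R w n" for n unfolding w_def using t(1)[of n] by simp
  have t_lim: "t \<longlonglongrightarrow> 0" unfolding t_def using LIMSEQ_inverse_real_of_nat by (simp add: inverse_eq_divide)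
  have "norm (w n - (y - u)) \<le> t n" for n
  proof -
    have "v n - ((1 - t n) *\<^sub>R u + t n *\<^sub>R y) = t n *\<^sub>R (w n - (y - u))"
      unfolding w by (simp add: algebra_simps)
    then have "t n * norm (w n - (y - u)) \<le> t n * t n" using v(2)[of n] t(1)[of n] by (simp add: power2_eq_square)
    then show ?thesis using t(1)[of n] by simp
  qed
  then have "(\<lambda>n. w n - (y - u)) \<longlonglongrightarrow> 0" by (intro Lim_null_comparison[OF _ t_lim]) auto
  then have w_lim: "w \<longlonglongrightarrow> y - u" by (simp add: LIM_zero_iff)
  have "(\<lambda>n. u + t n *\<^sub>R w n) \<longlonglongrightarrow> u + 0 *\<^sub>R (y - u)" by (intro tendsto_intros t_lim w_lim)
  then have v_lim: "v \<longlonglongrightarrow> u" by (simp flip: w)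
  have "(\<lambda>n. gd (v n)) \<longlonglongrightarrow> gd u"
    using continuous_on_tendsto_compose[OF gd_cont v_lim] u0 v(1) unfolding subdiff_domain_def by auto
  then have "(\<lambda>n. q (w n) + gd (v n) (w n)) \<longlonglongrightarrow> q (y - u) + gd u (y - u)"
    by (intro tendsto_intros w_lim)
  moreover have "0 \<le> q (w n) + gd (v n) (w n)" for n
  proof -
    have "v n \<in> X" using v(1) unfolding subdiff_domain_def by blast
    then have "q u + d u \<le> q (v n) + d (v n)" using u by (auto simp: is_arg_min_linorder)
    moreover have "d (v n) + gd (v n) (u - v n) \<le> d u" using gd_lower[OF v(1) uX] .
    ultimately have "0 \<le> t n * (q (w n) + gd (v n) (w n))"
      unfolding w by (simp add: blinfun.add_right blinfun.scaleR_right blinfun.minus_right algebra_simps)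
    then show ?thesis using t(1)[of n] by (simp add: zero_le_mult_iff)
  qed
  ultimately show "0 \<le> q (y - u) + gd u (y - u)" by (intro LIMSEQ_le_const) auto
qed

lemma start_point:
  assumes "is_arg_min d (\<lambda>x. x \<in> X) u"
  shows "u \<in> subdiff_domain" and "y \<in> X \<Longrightarrow> bregman u y \<le> d y - d u"
  using minimal_first_order[of 0 u] assms unfolding bregman_def by auto

text \<open>
  The variational inequality at the new point \<open>z\<close> and the three-point identity for Bregman distances leave the
  error \<open>p (x - z) - bregman x z\<close>. By strong convexity it is at most \<open>M r - r\<^sup>2 / 2 \<le> M\<^sup>2 / 2\<close> with
  \<open>r = N (x - z)\<close>.
\<close>

lemma mirror_step:
  fixes p :: "'a \<Rightarrow>\<^sub>L real"
  assumes x: "x \<in> subdiff_domain" and M: "\<And>u. p u \<le> M * N u"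
    and z: "z = arg_min_on (\<lambda>u. p u + d u - gd x u) X"
  shows "z \<in> subdiff_domain"
    and "y \<in> X \<Longrightarrow> p (x - y) \<le> M\<^sup>2 / 2 + bregman x y - bregman z y"
proof -
  have eq: "(\<lambda>u. p u + d u - gd x u) = (\<lambda>u. (p - gd x) u + d u)" by (auto simp: blinfun.diff_left)
  have "is_arg_min (\<lambda>u. (p - gd x) u + d u) (\<lambda>x. x \<in> X) z"
    unfolding z eq using linear_perturbation_has_min[of "p - gd x"] is_arg_min_arg_min_on by blast
  note opt = minimal_first_order[OF this]
  show z0: "z \<in> subdiff_domain" using opt(1) .
  assume "y \<in> X"
  have "0 \<le> p (y - z) - gd x (y - z) + gd z (y - z)" using opt(2)[OF \<open>y \<in> X\<close>] by (simp add: blinfun.diff_left)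
  moreover have "1 / 2 * (N (x - z))\<^sup>2 \<le> bregman x z"
    using bregman_ge[OF x, of z] z0 is_norm_minus_commute[OF norm, of x z] unfolding subdiff_domain_def by simp
  moreover have "p (x - z) \<le> M * N (x - z)" by (rule M)
  moreover have "M * N (x - z) \<le> M\<^sup>2 / 2 + 1 / 2 * (N (x - z))\<^sup>2"
    using sum_squares_bound[of M "N (x - z)"] by simp
  ultimately show "p (x - y) \<le> M\<^sup>2 / 2 + bregman x y - bregman z y"
    unfolding bregman_def by (simp add: blinfun.diff_right)
qed

end

section \<open>Adaptive Mirror Descent\<close>

text \<open>
  One run competes with an arbitrary feasible point \<open>y\<close> whose prox-distance from the starting point is controlled by
  \<open>\<Theta>\<^sub>0\<^sup>2\<close>; the restarts take the solution for \<open>y\<close>.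
\<close>

locale adaptive_mirror_descent =
  distance_generating "inner_norm A" "feasible A" "inner_prox A" "inner_prox_grad A"
  for A :: "'a::euclidean_space amd_input" +
  fixes f :: "'a \<Rightarrow> real" and y :: 'a
  assumes f_convex: "convex_on (feasible A) f"
    and g_convex: "convex_on (feasible A) (constraint A)"
    and f_subgrad: "\<And>x. x \<in> feasible A \<Longrightarrow> subgradient (feasible A) f x (obj_subgrad A x)"
    and g_subgrad: "\<And>x. x \<in> feasible A \<Longrightarrow> subgradient (feasible A) (constraint A) x (constr_subgrad A x)"
    and accuracy_pos: "inner_accuracy A > 0"
    and y_mem: "y \<in> feasible A" and y_feasible: "constraint A y \<le> 0"
    and theta: "\<And>c. is_arg_min (inner_prox A) (\<lambda>x. x \<in> feasible A) c \<Longrightarrow>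
      inner_prox A y \<le> inner_prox A c + inner_theta2 A"
begin

abbreviation "X \<equiv> feasible A"
abbreviation "x \<equiv> amd_iterate A"
abbreviation "\<delta> \<equiv> inner_accuracy A"
abbreviation "M k \<equiv> step_M A (x k)"
abbreviation "h k \<equiv> step_size A (x k)"

text \<open>
  The excess over \<open>y\<close> of the function whose subgradient the current step follows.
\<close>

definition gap :: "nat \<Rightarrow> real" where
  "gap k = (if productive A (x k) then f (x k) - f y else constraint A (x k) - constraint A y)"

lemma start: "is_arg_min (inner_prox A) (\<lambda>x. x \<in> X) (x 0)"
  using d_min is_arg_min_arg_min_on[where \<phi> = "inner_prox A" and X = X] by auto

lemma scaled_step_subgrad_le:
  "(step_size A z *\<^sub>R step_subgrad A z) u \<le> (step_size A z * step_M A z) * inner_norm A u"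
proof -
  have "0 \<le> step_size A z" using accuracy_pos unfolding step_size_def by simp
  then show ?thesis using le_dual_norm_mult[OF norm, of "step_subgrad A z" u]
    unfolding step_M_def by (simp add: blinfun.scaleR_left mult_left_mono mult.assoc)
qed

lemma iterate_subdiff: "x k \<in> subdiff_domain"
proof (induction k)
  case 0
  show ?case using start_point(1)[OF start] .
next
  case (Suc k)
  show ?case by (rule mirror_step(1)[OF Suc scaled_step_subgrad_le]) (simp add: mirr_def)
qed

lemma iterate_mem: "x k \<in> X"
  using iterate_subdiff unfolding subdiff_domain_def by blast

lemma gap_le: "gap k \<le> step_subgrad A (x k) (x k - y)"
proof -
  have "f (x k) + obj_subgrad A (x k) (y - x k) \<le> f y"
    "constraint A (x k) + constr_subgrad A (x k) (y - x k) \<le> constraint A y"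
    using f_subgrad[OF iterate_mem] g_subgrad[OF iterate_mem] y_mem unfolding subgradient_def by blast+
  then show ?thesis unfolding gap_def step_subgrad_def by (simp add: blinfun.diff_right)
qed

text \<open>
  With \<open>h = \<delta> / M\<^sup>2\<close> the error \<open>h\<^sup>2 M\<^sup>2 / 2\<close> of a mirror step is \<open>\<delta> h / 2\<close>, that is, half the accuracy in the
  weight of this step.
\<close>

lemma progress:
  assumes "M k \<noteq> 0"
  shows "h k * gap k \<le> \<delta> / 2 * h k + bregman (x k) y - bregman (x (Suc k)) y"
proof -
  have h: "h k > 0" using assms accuracy_pos unfolding step_size_def by simp
  have "h k * gap k \<le> (h k *\<^sub>R step_subgrad A (x k)) (x k - y)"
    using gap_le h by (simp add: blinfun.scaleR_left)
  also have "\<dots> \<le> (h k * M k)\<^sup>2 / 2 + bregman (x k) y - bregman (x (Suc k)) y"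
    by (rule mirror_step(2)[OF iterate_subdiff scaled_step_subgrad_le _ y_mem]) (simp add: mirr_def)
  also have "(h k * M k)\<^sup>2 = \<delta> * h k"
    using assms unfolding step_size_def by (simp add: power2_eq_square)
  finally show ?thesis by simp
qed

text \<open>
  Telescoping \<open>progress\<close> spends \<open>\<delta> / 2\<close> of the accuracy per unit weight, and the stopping criterion says exactly
  that the bound \<open>\<Theta>\<^sub>0\<^sup>2\<close> on the initial Bregman distance is covered by the other half.
\<close>

lemma weighted_gaps_le:
  assumes "\<And>k. k < n \<Longrightarrow> M k \<noteq> 0" "(\<Sum>k<n. 1 / (M k)\<^sup>2) \<ge> 2 * inner_theta2 A / \<delta>\<^sup>2"
  shows "(\<Sum>k<n. h k * (gap k - \<delta>)) \<le> 0"
proof -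
  have "(\<Sum>k<n. h k * gap k) \<le> (\<Sum>k<n. \<delta> / 2 * h k + (bregman (x k) y - bregman (x (Suc k)) y))"
    using progress[OF assms(1)] by (intro sum_mono) (simp add: algebra_simps)
  also have "\<dots> = \<delta> / 2 * (\<Sum>k<n. h k) + (bregman (x 0) y - bregman (x n) y)"
    unfolding sum.distrib sum_distrib_left by (simp del: amd_iterate.simps add: sum_lessThan_telescope'[of "\<lambda>k. bregman (x k) y"])
  also have "\<dots> \<le> \<delta> / 2 * (\<Sum>k<n. h k) + inner_theta2 A"
  proof -
    have "bregman (x 0) y \<le> inner_theta2 A" using start_point(2)[OF start y_mem] theta[OF start] by linarith
    moreover have "0 \<le> bregman (x n) y"
      using bregman_ge[OF iterate_subdiff[of n] y_mem] zero_le_power2[of "inner_norm A (y - x n)"] by linarith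
    ultimately show ?thesis by linarith
  qed
  also have "inner_theta2 A \<le> \<delta> / 2 * (\<Sum>k<n. h k)"
  proof -
    have "(\<Sum>k<n. h k) = \<delta> * (\<Sum>k<n. 1 / (M k)\<^sup>2)"
      unfolding step_size_def by (simp add: sum_distrib_left)
    moreover have "inner_theta2 A \<le> \<delta>\<^sup>2 / 2 * (\<Sum>k<n. 1 / (M k)\<^sup>2)"
      using assms(2) accuracy_pos by (simp add: field_simps)
    ultimately show ?thesis by (simp add: power2_eq_square)
  qed
  finally show ?thesis by (simp add: right_diff_distrib sum_subtractf sum_distrib_left mult.commute)
qed

text \<open>
  A vanishing subgradient makes the iterate a minimiser over \<open>X\<close> of the function in question. This cannot be the constraint
  at a step with \<open>g > \<delta>\<close>, since \<open>y\<close> is feasible.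
\<close>

lemma output_degenerate:
  assumes "M k = 0"
  shows "f (x k) \<le> f y" and "constraint A (x k) \<le> \<delta>"
proof -
  have "step_subgrad A (x k) = 0" using assms dual_norm_eq_0[OF norm] unfolding step_M_def by blast
  then have "gap k \<le> 0" using gap_le[of k] by simp
  then show "f (x k) \<le> f y" "constraint A (x k) \<le> \<delta>"
    using y_feasible accuracy_pos unfolding gap_def productive_def by (auto split: if_splits)
qed

text \<open>
  At a step that is not productive the gap exceeds \<open>\<delta>\<close>. As the weighted gaps exceed \<open>\<delta>\<close> by a nonpositive total,
  some step is productive, and over the productive steps alone the total is still nonpositive.
  Jensen's inequality transfers both bounds to the average.
\<close>

lemma output_average:
  assumes n: "n > 0" and M: "\<And>k. k < n \<Longrightarrow> M k \<noteq> 0"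
    and stop: "(\<Sum>k<n. 1 / (M k)\<^sup>2) \<ge> 2 * inner_theta2 A / \<delta>\<^sup>2"
  defines "I \<equiv> {i. i < n \<and> productive A (x i)}"
  defines "z \<equiv> (\<Sum>i\<in>I. h i *\<^sub>R x i) /\<^sub>R (\<Sum>i\<in>I. h i)"
  shows "z \<in> X" and "f z \<le> f y + \<delta>" and "constraint A z \<le> \<delta>"
proof -
  have h: "h k > 0" if "k < n" for k using M[OF that] accuracy_pos unfolding step_size_def by simp
  have I: "finite I" "I \<subseteq> {..<n}" unfolding I_def by auto
  have unprod: "h k * (gap k - \<delta>) > 0" if "k \<in> {..<n} - I" for k
    using that h[of k] y_feasible unfolding I_def gap_def productive_def by auto
  have le0: "(\<Sum>k\<in>I. h k * (gap k - \<delta>)) + (\<Sum>k\<in>{..<n} - I. h k * (gap k - \<delta>)) \<le> 0"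
    using weighted_gaps_le[OF M stop] sum.subset_diff[OF I(2), of "\<lambda>k. h k * (gap k - \<delta>)"] by simp
  have ne: "I \<noteq> {}"
  proof
    assume "I = {}"
    then have "0 < (\<Sum>k<n. h k * (gap k - \<delta>))" using unprod n by (intro sum_pos) auto
    then show False using le0 \<open>I = {}\<close> by simp
  qed
  have le: "(\<Sum>k\<in>I. h k * (f (x k) - f y - \<delta>)) \<le> 0"
  proof -
    have "0 \<le> (\<Sum>k\<in>{..<n} - I. h k * (gap k - \<delta>))" using unprod by (intro sum_nonneg less_imp_le) auto
    moreover have "(\<Sum>k\<in>I. h k * (gap k - \<delta>)) = (\<Sum>k\<in>I. h k * (f (x k) - f y - \<delta>))"
      by (intro sum.cong) (auto simp: gap_def I_def)
    ultimately show ?thesis using le0 by simp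
  qed
  define H where "H = (\<Sum>i\<in>I. h i)"
  have H: "H > 0" unfolding H_def using ne I h by (intro sum_pos) auto
  define a where "a i = h i / H" for i
  have a: "\<And>i. i \<in> I \<Longrightarrow> 0 \<le> a i" "sum a I = 1"
    unfolding a_def using h I H by (auto simp: less_imp_le subset_iff H_def simp flip: sum_divide_distrib)
  have z: "z = (\<Sum>i\<in>I. a i *\<^sub>R x i)"
    unfolding z_def a_def H_def[symmetric] by (simp add: scaleR_sum_right divide_inverse mult.commute)
  show "z \<in> X" unfolding z using convex_sum[OF I(1) convex a(2)] a(1) iterate_mem by blast
  have "f z \<le> (\<Sum>i\<in>I. a i * f (x i))" unfolding z
    using convex_on_sum[OF I(1) ne f_convex a(2)] a(1) iterate_mem by blast
  also have "\<dots> = (\<Sum>k\<in>I. h k * (f (x k) - f y - \<delta>)) / H + (f y + \<delta>) * sum a I"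
    unfolding a_def sum_divide_distrib sum_distrib_left sum.distrib[symmetric]
    using H by (intro sum.cong) (auto simp: field_simps)
  also have "\<dots> \<le> f y + \<delta>" using le H a(2) by (simp add: divide_nonpos_pos)
  finally show "f z \<le> f y + \<delta>" .
  have "constraint A z \<le> (\<Sum>i\<in>I. a i * constraint A (x i))" unfolding z
    using convex_on_sum[OF I(1) ne g_convex a(2)] a(1) iterate_mem by blast
  also have "\<dots> \<le> (\<Sum>i\<in>I. a i * \<delta>)"
    using a(1) by (intro sum_mono mult_left_mono) (auto simp: I_def productive_def)
  also have "\<dots> = \<delta>" using a(2) by (simp flip: sum_distrib_right)
  finally show "constraint A z \<le> \<delta>" .
qed

theorem output_accuracy:
  assumes "amd_terminates A"
  shows "amd_output A \<in> X" and "f (amd_output A) \<le> f y + \<delta>" and "constraint A (amd_output A) \<le> \<delta>"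
proof -
  define n where "n = amd_iterations A"
  have "n \<ge> 1 \<and> amd_stop A n"
    unfolding n_def amd_iterations_def using assms unfolding amd_terminates_def
    by (rule LeastI_ex)
  then have n: "n \<ge> 1" "amd_stop A n" by auto
  have "amd_output A \<in> X \<and> f (amd_output A) \<le> f y + \<delta> \<and> constraint A (amd_output A) \<le> \<delta>"
  proof (cases "M (n - 1) = 0")
    case True
    then have "amd_output A = x (n - 1)" unfolding amd_output_def n_def[symmetric] Let_def by simp
    then show ?thesis using output_degenerate[OF True] iterate_mem accuracy_pos by simp
  next
    case False
    \<comment> \<open>An earlier vanishing \<open>M\<^sub>j\<close> would already have stopped the run at \<open>j + 1 < n\<close>.\<close>
    have nz: "M j \<noteq> 0" if "j < n" for j
    proof
      assume "M j = 0"
      then have "amd_stop A (Suc j)" unfolding amd_stop_def by auto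
      then have "n \<le> Suc j" unfolding n_def amd_iterations_def by (intro Least_le) auto
      then show False using that False \<open>M j = 0\<close> by (simp add: le_Suc_eq)
    qed
    then have "(\<Sum>k<n. 1 / (M k)\<^sup>2) \<ge> 2 * inner_theta2 A / \<delta>\<^sup>2"
      using n(2) unfolding amd_stop_def by auto
    moreover have "amd_output A = (\<Sum>i\<in>{i. i < n \<and> productive A (x i)}. h i *\<^sub>R x i) /\<^sub>R
        (\<Sum>i\<in>{i. i < n \<and> productive A (x i)}. h i)"
      using False unfolding amd_output_def n_def[symmetric] Let_def by simp
    ultimately show ?thesis using output_average[of n] nz n(1) by simp
  qed
  then show "amd_output A \<in> X" "f (amd_output A) \<le> f y + \<delta>" "constraint A (amd_output A) \<le> \<delta>"
    by auto
qed

theorem iterations_le: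
  assumes M: "\<And>z. z \<in> X \<Longrightarrow> (step_M A z)\<^sup>2 \<le> L"
  shows "amd_terminates A" and "real (amd_iterations A) \<le> 1 + 2 * inner_theta2 A * L / \<delta>\<^sup>2"
proof -
  define b where "b = 2 * inner_theta2 A * L / \<delta>\<^sup>2"
  have "0 \<le> inner_theta2 A" using theta[OF start] start y_mem by (auto simp: is_arg_min_linorder)
  moreover have "0 \<le> L" using M[OF y_mem] zero_le_power2 order_trans by blast
  ultimately have b: "b \<ge> 0" unfolding b_def by simp
  \<comment> \<open>At least one step is made, even when \<open>b = 0\<close>.\<close>
  define k where "k = max 1 (nat \<lceil>b\<rceil>)"
  have k: "k \<ge> 1" "b \<le> real k" "real k \<le> 1 + b" using b unfolding k_def by linarith+
  have stop: "amd_stop A k"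
  proof (cases "\<exists>j<k. M j = 0")
    case False
    then have nz: "M j \<noteq> 0" if "j < k" for j using that by blast
    have "(M 0)\<^sup>2 > 0" using nz[of 0] k(1) by simp
    then have L: "L > 0" using M[OF iterate_mem, of 0] by linarith
    have "2 * inner_theta2 A / \<delta>\<^sup>2 = b / L" unfolding b_def using L by simp
    also have "\<dots> \<le> real k / L" using k(2) L by (simp add: divide_right_mono)
    also have "\<dots> = (\<Sum>j<k. 1 / L)" by simp
    also have "\<dots> \<le> (\<Sum>j<k. 1 / (M j)\<^sup>2)"
      using nz M[OF iterate_mem] L by (intro sum_mono frac_le) auto
    finally show ?thesis unfolding amd_stop_def by blast
  qed (auto simp: amd_stop_def)
  then show "amd_terminates A" using k(1) unfolding amd_terminates_def by blast
  have "amd_iterations A \<le> k" unfolding amd_iterations_def using stop k(1) by (intro Least_le) auto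
  then show "real (amd_iterations A) \<le> 1 + 2 * inner_theta2 A * L / \<delta>\<^sup>2"
    using k(3) unfolding b_def by linarith
qed

end

section \<open>Rescaling of prox-functions\<close>

text \<open>
  Under the affine map \<open>s u = (u - c) / R\<close> the subgradients at \<open>u\<close> of \<open>d \<circ> s\<close> on \<open>X\<close> are those of \<open>d\<close> at \<open>s u\<close> on
  \<open>s ` X\<close> divided by \<open>R\<close>, and strong convexity with respect to \<open>N\<close> becomes strong convexity with respect to \<open>N / R\<close>.
\<close>

lemma prox_function_rescale:
  fixes N :: "'a::euclidean_space \<Rightarrow> real"
  assumes N: "is_norm N" and X: "closed X" "convex X" and R: "R > 0"
    and prox: "prox_function N ((\<lambda>x. (x - c) /\<^sub>R R) ` X) d gd"
  shows "distance_generating (\<lambda>u. N u / R) X (\<lambda>u. d ((u - c) /\<^sub>R R)) (\<lambda>u. gd ((u - c) /\<^sub>R R) /\<^sub>R R)"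
proof -
  define s where "s x = (x - c) /\<^sub>R R" for x
  let ?S = "s ` X"
  have diff: "s y - s x = (y - x) /\<^sub>R R" for x y unfolding s_def by (simp flip: scaleR_diff_right)
  have s_cont: "continuous_on A s" for A unfolding s_def by (intro continuous_intros)
  define S0 where "S0 = {x \<in> ?S. \<exists>p. subgradient ?S d x p}"
  have prox: "continuous_on ?S d" "convex_on ?S d" "continuous_on S0 gd"
    "\<And>x y. x \<in> S0 \<Longrightarrow> y \<in> ?S \<Longrightarrow> d y - d x - gd x (y - x) \<ge> 1 / 2 * (N (y - x))\<^sup>2"
    "is_arg_min d (\<lambda>x. x \<in> ?S) 0"
    using prox unfolding prox_function_def Let_def S0_def s_def by auto
  have sub: "s x \<in> S0" if "subgradient X (\<lambda>u. d (s u)) x p" for x and p :: "'a \<Rightarrow>\<^sub>L real"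
  proof -
    have "(R *\<^sub>R p) (s y - s x) = p (y - x)" for y
      using R unfolding diff by (simp add: blinfun.scaleR_left blinfun.scaleR_right)
    then have "subgradient ?S d (s x) (R *\<^sub>R p)" using that by (auto simp: subgradient_def)
    then show ?thesis unfolding S0_def subgradient_def by blast
  qed
  have "distance_generating (\<lambda>u. N u / R) X (\<lambda>u. d (s u)) (\<lambda>u. gd (s u) /\<^sub>R R)"
  proof
    show "is_norm (\<lambda>u. N u / R)" using is_norm_divide[OF N R] .
    show "closed X" "convex X" using X by auto
    show "continuous_on X (\<lambda>u. d (s u))" using continuous_on_compose2[OF prox(1) s_cont] by blast
    show "convex_on X (\<lambda>u. d (s u))"
    proof (rule convex_onI[OF _ X(2)])
      fix t :: real and x y assume t: "0 < t" "t < 1" and xy: "x \<in> X" "y \<in> X"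
      have "s ((1 - t) *\<^sub>R x + t *\<^sub>R y) = (1 - t) *\<^sub>R s x + t *\<^sub>R s y"
        unfolding s_def by (simp add: algebra_simps)
      then show "d (s ((1 - t) *\<^sub>R x + t *\<^sub>R y)) \<le> (1 - t) * d (s x) + t * d (s y)"
        using convex_onD[OF prox(2), of t "s x" "s y"] t xy by simp
    qed
    obtain c' where "c' \<in> X" "s c' = 0" using prox(5) unfolding is_arg_min_def by auto
    then show "\<exists>c. is_arg_min (\<lambda>u. d (s u)) (\<lambda>x. x \<in> X) c" using prox(5)
      by (intro exI[of _ c']) (auto simp: is_arg_min_linorder)
    show "continuous_on {x \<in> X. \<exists>p. subgradient X (\<lambda>u. d (s u)) x p} (\<lambda>u. gd (s u) /\<^sub>R R)"
      by (intro continuous_intros continuous_on_compose2[OF prox(3) s_cont]) (use sub in auto)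
    fix x y and p :: "'a \<Rightarrow>\<^sub>L real"
    assume "subgradient X (\<lambda>u. d (s u)) x p" "y \<in> X"
    then have "d (s y) - d (s x) - gd (s x) (s y - s x) \<ge> 1 / 2 * (N (s y - s x))\<^sup>2"
      using prox(4) sub by blast
    moreover have "N (s y - s x) = N (y - x) / R"
      using N R unfolding diff is_norm_def by (simp add: divide_inverse mult.commute)
    ultimately show "d (s x) + (gd (s x) /\<^sub>R R) (y - x) + 1 / 2 * (N (y - x) / R)\<^sup>2 \<le> d (s y)"
      unfolding diff by (simp add: blinfun.scaleR_left blinfun.scaleR_right)
  qed
  then show ?thesis unfolding s_def .
qed

section \<open>Quadratic growth at a constrained minimiser\<close>

text \<open>
  Strong convexity in Jensen form, from the two subgradient inequalities at the intermediate point towards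
  both endpoints: the linear terms cancel in the convex combination.
\<close>

lemma strongly_convex_combination:
  assumes N: "is_norm N" and \<phi>: "strongly_convex N \<mu> D X \<phi>"
    and ab: "a \<in> X" "b \<in> X" and t: "0 \<le> t" "t \<le> 1"
    and z: "(1 - t) *\<^sub>R a + t *\<^sub>R b \<in> X"
    and p: "subgradient D \<phi> ((1 - t) *\<^sub>R a + t *\<^sub>R b) p"
  shows "\<phi> ((1 - t) *\<^sub>R a + t *\<^sub>R b) + \<mu> / 2 * (t * (1 - t)) * (N (b - a))\<^sup>2 \<le> (1 - t) * \<phi> a + t * \<phi> b"
proof -
  define z where "z = (1 - t) *\<^sub>R a + t *\<^sub>R b"
  define n where "n = (N (b - a))\<^sup>2"
  define q where "q = p (b - a)"
  have diff: "a - z = (- t) *\<^sub>R (b - a)" "b - z = (1 - t) *\<^sub>R (b - a)" unfolding z_def by (simp_all add: algebra_simps)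
  have scale: "N (c *\<^sub>R v) = \<bar>c\<bar> * N v" for c v using N unfolding is_norm_def by blast
  have Nd: "(N (a - z))\<^sup>2 = t\<^sup>2 * n" "(N (b - z))\<^sup>2 = (1 - t)\<^sup>2 * n"
    unfolding diff scale n_def by (simp_all only: power_mult_distrib power2_abs power2_minus)
  have pd: "p (a - z) = - t * q" "p (b - z) = (1 - t) * q"
    unfolding diff q_def by (simp_all only: blinfun.scaleR_right real_scaleR_def)
  have a: "\<phi> z - t * q + \<mu> / 2 * (t\<^sup>2 * n) \<le> \<phi> a"
    and b: "\<phi> z + (1 - t) * q + \<mu> / 2 * ((1 - t)\<^sup>2 * n) \<le> \<phi> b"
    using \<phi> ab z p Nd pd unfolding strongly_convex_def z_def[symmetric] by fastforce+
  have "\<phi> z + \<mu> / 2 * (t * (1 - t)) * n =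
      (1 - t) * (\<phi> z - t * q + \<mu> / 2 * (t\<^sup>2 * n)) + t * (\<phi> z + (1 - t) * q + \<mu> / 2 * ((1 - t)\<^sup>2 * n))"
    by (simp add: field_simps power2_eq_square)
  also have "\<dots> \<le> (1 - t) * \<phi> a + t * \<phi> b" using a b t by (intro add_mono mult_left_mono) auto
  finally show ?thesis unfolding z_def n_def .
qed

text \<open>
  The minimiser of the constrained problem minimises \<open>max (f - f xstar) g\<close> over \<open>X\<close>, with value \<open>0\<close>, because an infeasible
  point has \<open>g > 0\<close>. Along the segment from \<open>xstar\<close> to \<open>x\<close> the strong convexity of both functions makes this maximum
  at most \<open>t e - \<mu>/2 t (1 - t) (N (x - xstar))\<^sup>2\<close>, which therefore is nonnegative; divide by \<open>t\<close> and let \<open>t\<close> tend to \<open>0\<close>.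
\<close>

lemma quadratic_growth:
  assumes N: "is_norm N" and X: "convex X"
    and f: "strongly_convex N \<mu> X X f" "\<And>x. x \<in> X \<Longrightarrow> \<exists>p. subgradient X f x p"
    and g: "strongly_convex N \<mu> D X g" "\<And>x. x \<in> X \<Longrightarrow> \<exists>p. subgradient D g x p"
    and opt: "is_arg_min f (\<lambda>x. x \<in> X \<and> g x \<le> 0) xstar"
    and x: "x \<in> X" "f x \<le> f xstar + e" "g x \<le> e"
  shows "\<mu> / 2 * (N (x - xstar))\<^sup>2 \<le> e"
proof -
  have s: "xstar \<in> X" "g xstar \<le> 0" and best: "\<And>z. z \<in> X \<Longrightarrow> g z \<le> 0 \<Longrightarrow> f xstar \<le> f z"
    using opt by (auto simp: is_arg_min_linorder)
  define n where "n = (N (x - xstar))\<^sup>2"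
  have ineq: "\<mu> / 2 * (1 - t) * n \<le> e" if t: "0 < t" "t < 1" for t
  proof -
    let ?z = "(1 - t) *\<^sub>R xstar + t *\<^sub>R x"
    have z: "?z \<in> X" using X s x t by (simp add: convex_def)
    obtain p q where "subgradient X f ?z p" "subgradient D g ?z q" using f(2) g(2) z by blast
    then have F: "f ?z + \<mu> / 2 * (t * (1 - t)) * n \<le> (1 - t) * f xstar + t * f x"
      and G: "g ?z + \<mu> / 2 * (t * (1 - t)) * n \<le> (1 - t) * g xstar + t * g x"
      using strongly_convex_combination[OF N f(1) s(1) x(1) _ _ z]
        strongly_convex_combination[OF N g(1) s(1) x(1) _ _ z] t unfolding n_def by simp_all
    have "\<mu> / 2 * (t * (1 - t)) * n \<le> t * e"
    proof (cases "g ?z \<le> 0")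
      case True
      have "t * f x \<le> t * (f xstar + e)" using x(2) t by simp
      then have "(1 - t) * f xstar + t * f x \<le> f xstar + t * e" by (simp add: algebra_simps)
      then show ?thesis using F best[OF z True] by linarith
    next
      case False
      have "t * g x \<le> t * e" "(1 - t) * g xstar \<le> 0" using x(3) s(2) t by (simp_all add: mult_nonneg_nonpos)
      then show ?thesis using G False by linarith
    qed
    then have "t * (\<mu> / 2 * (1 - t) * n) \<le> t * e" by (simp add: mult_ac)
    then show ?thesis using t by simp
  qed
  have "\<mu> / 2 * n \<le> e"
  proof (rule tendsto_upperbound)
    show "((\<lambda>t. \<mu> / 2 * (1 - t) * n) \<longlongrightarrow> \<mu> / 2 * n) (at_right 0)"
      by (auto intro!: tendsto_eq_intros)
    show "\<forall>\<^sub>F t in at_right 0. \<mu> / 2 * (1 - t) * n \<le> e"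
      using eventually_at_right_less[of 0] eventually_at_right_real[OF zero_less_one]
      by eventually_elim (use ineq in auto)
  qed simp
  then show ?thesis unfolding n_def .
qed

section \<open>The restarted method\<close>

lemma restart_radius_square: "(restart_radius R p)\<^sup>2 = R\<^sup>2 / 2 ^ p"
  unfolding restart_radius_def by simp

lemma restart_radius_pos: "R > 0 \<Longrightarrow> restart_radius R p > 0"
  unfolding restart_radius_def by simp

lemma restart_radius_le: "R > 0 \<Longrightarrow> restart_radius R p \<le> R"
  by (rule power2_le_imp_le) (simp_all add: restart_radius_square divide_le_eq mult_le_cancel_left1 one_le_power)

lemma restart_accuracy_eq: "restart_accuracy \<mu> R p = \<mu> * R\<^sup>2 / 2 / 2 ^ p"
  unfolding restart_accuracy_def restart_radius_square by simp

locale restarted_mirror_descent =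
  fixes N :: "'a::euclidean_space \<Rightarrow> real" and X :: "'a set" and f g :: "'a \<Rightarrow> real"
    and gf gg gd :: "'a \<Rightarrow> ('a \<Rightarrow>\<^sub>L real)" and d :: "'a \<Rightarrow> real"
    and \<mu> \<Omega> R\<^sub>0 :: real and x\<^sub>0 xstar :: 'a
  assumes norm: "is_norm N" and closed: "closed X" and convex: "convex X"
    and f_convex: "convex_on X f" and g_convex: "convex_on UNIV g"
    and optimal: "is_arg_min f (\<lambda>x. x \<in> X \<and> g x \<le> 0) xstar"
    and f_subgrad: "\<forall>x\<in>X. subgradient X f x (gf x)"
    and g_subgrad: "\<forall>x\<in>X. subgradient UNIV g x (gg x)"
    and \<mu>_pos: "\<mu> > 0"
    and f_strong: "strongly_convex N \<mu> X X f" and g_strong: "strongly_convex N \<mu> UNIV X g"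
    and prox: "\<forall>S\<in>prox_domains X R\<^sub>0. prox_function N S d gd"
    and prox_bound: "\<forall>S\<in>prox_domains X R\<^sub>0. \<forall>x\<in>S. N x \<le> 1 \<longrightarrow> d x \<le> \<Omega> / 2"
    and x0_mem: "x\<^sub>0 \<in> X" and R0_pos: "R\<^sub>0 > 0" and x0_near: "(N (x\<^sub>0 - xstar))\<^sup>2 \<le> R\<^sub>0\<^sup>2"
begin

abbreviation "G \<equiv> stage_input X g gf gg N d gd \<mu> \<Omega> R\<^sub>0"
abbreviation "R \<equiv> restart_radius R\<^sub>0"
abbreviation "x \<equiv> restart_point G x\<^sub>0"

lemma \<Omega>_nonneg: "\<Omega> \<ge> 0"
proof -
  have "X \<in> prox_domains X R\<^sub>0" unfolding prox_domains_def by simp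
  then have "is_arg_min d (\<lambda>x. x \<in> X) 0" "d 0 = 0" "\<And>x. x \<in> X \<Longrightarrow> N x \<le> 1 \<Longrightarrow> d x \<le> \<Omega> / 2"
    using prox prox_bound unfolding prox_function_def Let_def by blast+
  then show ?thesis using is_norm_zero[OF norm] by (force simp: is_arg_min_def)
qed

text \<open>
  As long as the centre is within \<open>R\<^sub>p\<close> of the solution, the rescaled solution lies in the unit ball, where the prox-function
  is at most \<open>\<Omega> / 2 = \<Theta>\<^sub>0\<^sup>2\<close>.
\<close>

lemma stage:
  assumes c: "c \<in> X" "(N (c - xstar))\<^sup>2 \<le> (R p)\<^sup>2"
  shows "adaptive_mirror_descent (G c p) f xstar"
proof -
  have Rp: "R p > 0" "R p \<le> R\<^sub>0" using restart_radius_pos restart_radius_le R0_pos by blast+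
  define S where "S = (\<lambda>x. (x - c) /\<^sub>R R p) ` X"
  have S: "S \<in> prox_domains X R\<^sub>0" unfolding S_def prox_domains_def using c Rp by blast
  then have pS: "prox_function N S d gd" using prox by blast
  have s: "xstar \<in> X" "g xstar \<le> 0" using optimal by (auto simp: is_arg_min_def)
  have dg: "distance_generating (\<lambda>u. N u / R p) X (\<lambda>u. d ((u - c) /\<^sub>R R p)) (\<lambda>u. gd ((u - c) /\<^sub>R R p) /\<^sub>R R p)"
    using prox_function_rescale[OF norm closed convex Rp(1)] pS unfolding S_def by blast
  have "d ((xstar - c) /\<^sub>R R p) \<le> \<Omega> / 2"
  proof -
    have "N (xstar - c) \<le> R p"
      using power2_le_imp_le[OF c(2)] Rp(1) is_norm_minus_commute[OF norm] by (metis less_imp_le)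
    moreover have "N ((xstar - c) /\<^sub>R R p) = \<bar>inverse (R p)\<bar> * N (xstar - c)"
      using norm unfolding is_norm_def by blast
    moreover have "\<bar>inverse (R p)\<bar> * N (xstar - c) \<le> 1" if "N (xstar - c) \<le> R p"
      using that Rp(1) by (simp add: divide_simps)
    ultimately have "N ((xstar - c) /\<^sub>R R p) \<le> 1" by presburger
    moreover have "(xstar - c) /\<^sub>R R p \<in> S" unfolding S_def using s(1) by (rule imageI)
    ultimately show ?thesis using prox_bound S by metis
  qed
  moreover have "0 \<le> d ((z - c) /\<^sub>R R p)" if "z \<in> X" for z
    using pS that unfolding prox_function_def Let_def S_def is_arg_min_linorder by auto
  ultimately have theta: "d ((xstar - c) /\<^sub>R R p) \<le> d ((z - c) /\<^sub>R R p) + \<Omega> / 2" if "z \<in> X" for z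
    using that by fastforce
  have fields: "feasible (G c p) = X" "constraint (G c p) = g" "obj_subgrad (G c p) = gf"
    "constr_subgrad (G c p) = gg" "inner_norm (G c p) = (\<lambda>u. N u / R p)"
    "inner_prox (G c p) = (\<lambda>u. d ((u - c) /\<^sub>R R p))"
    "inner_prox_grad (G c p) = (\<lambda>u. gd ((u - c) /\<^sub>R R p) /\<^sub>R R p)"
    "inner_accuracy (G c p) = restart_accuracy \<mu> R\<^sub>0 (Suc p)" "inner_theta2 (G c p) = \<Omega> / 2"
    by (simp_all add: stage_input_def Let_def)
  show ?thesis
  proof (intro adaptive_mirror_descent.intro adaptive_mirror_descent_axioms.intro, unfold fields)
    show "convex_on X g" using g_convex convex convex_on_subset by blast
    show "subgradient X g z (gg z)" if "z \<in> X" for z using g_subgrad that by (auto simp: subgradient_def)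
    show "0 < restart_accuracy \<mu> R\<^sub>0 (Suc p)" using \<mu>_pos R0_pos by (simp add: restart_accuracy_eq)
  qed (use dg f_convex f_subgrad s theta in \<open>auto simp: is_arg_min_def\<close>)
qed

text \<open>
  The accuracy of stage \<open>p + 1\<close> is \<open>\<mu>/2\<close> times the square of the next radius, so quadratic growth turns accuracy
  in value into the distance bound required by the next stage.
\<close>

lemma stage_result:
  assumes c: "c \<in> X" "(N (c - xstar))\<^sup>2 \<le> (R p)\<^sup>2" and stops: "amd_terminates (G c p)"
  defines "z \<equiv> amd_output (G c p)"
  shows "z \<in> X" "f z \<le> f xstar + restart_accuracy \<mu> R\<^sub>0 (Suc p)" "g z \<le> restart_accuracy \<mu> R\<^sub>0 (Suc p)"
    and "(N (z - xstar))\<^sup>2 \<le> (R (Suc p))\<^sup>2"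
proof -
  interpret amd: adaptive_mirror_descent "G c p" f xstar by (rule stage[OF c])
  have fields: "feasible (G c p) = X" "constraint (G c p) = g"
    "inner_accuracy (G c p) = restart_accuracy \<mu> R\<^sub>0 (Suc p)"
    by (simp_all add: stage_input_def Let_def)
  show z: "z \<in> X" "f z \<le> f xstar + restart_accuracy \<mu> R\<^sub>0 (Suc p)" "g z \<le> restart_accuracy \<mu> R\<^sub>0 (Suc p)"
    using amd.output_accuracy[OF stops] unfolding z_def fields by auto
  have "\<mu> / 2 * (N (z - xstar))\<^sup>2 \<le> restart_accuracy \<mu> R\<^sub>0 (Suc p)"
    by (rule quadratic_growth[OF norm convex f_strong _ g_strong _ optimal z]) (use f_subgrad g_subgrad in blast)+
  then show "(N (z - xstar))\<^sup>2 \<le> (R (Suc p))\<^sup>2" using \<mu>_pos by (simp add: restart_accuracy_def)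
qed

lemma restart_point_near:
  assumes "restart_terminates G x\<^sub>0 p"
  shows "x p \<in> X \<and> (N (x p - xstar))\<^sup>2 \<le> (R p)\<^sup>2"
  using assms
proof (induction p)
  case 0
  then show ?case using x0_mem x0_near by (simp add: restart_radius_square)
next
  case (Suc p)
  then have "amd_terminates (G (x p) p)" "restart_terminates G x\<^sub>0 p" unfolding restart_terminates_def by auto
  then show ?case using Suc.IH stage_result[of "x p" p] by simp
qed

lemma restart_point_accuracy:
  assumes "restart_terminates G x\<^sub>0 p" "p \<ge> 1"
  shows "f (x p) \<le> f xstar + restart_accuracy \<mu> R\<^sub>0 p" "g (x p) \<le> restart_accuracy \<mu> R\<^sub>0 p"
    "\<mu> / 2 * (N (x p - xstar))\<^sup>2 \<le> restart_accuracy \<mu> R\<^sub>0 p"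
proof -
  obtain q where q: "p = Suc q" using assms(2) by (cases p) auto
  have "restart_terminates G x\<^sub>0 q" "amd_terminates (G (x q) q)"
    using assms(1) unfolding q restart_terminates_def by auto
  then have "f (x p) \<le> f xstar + restart_accuracy \<mu> R\<^sub>0 p \<and> g (x p) \<le> restart_accuracy \<mu> R\<^sub>0 p"
    using restart_point_near[of q] stage_result[of "x q" q] unfolding q by simp
  then show "f (x p) \<le> f xstar + restart_accuracy \<mu> R\<^sub>0 p" "g (x p) \<le> restart_accuracy \<mu> R\<^sub>0 p" by auto
  show "\<mu> / 2 * (N (x p - xstar))\<^sup>2 \<le> restart_accuracy \<mu> R\<^sub>0 p"
    using restart_point_near[OF assms(1)] \<mu>_pos by (simp add: restart_accuracy_def)
qed

text \<open>
  In the norm \<open>N / R\<^sub>p\<close> the dual norms are scaled by \<open>R\<^sub>p\<close>, so the bound on the count, apart from the first step, is proportional to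
  \<open>R\<^sub>p\<^sup>2 / \<epsilon>\<^sub>p\<^sub>+\<^sub>1\<^sup>2\<close>, which doubles from one stage to the next.
\<close>

lemma stage_iterations:
  assumes L: "\<And>z. z \<in> X \<Longrightarrow> (dual_norm N (gf z))\<^sup>2 \<le> L \<and> (dual_norm N (gg z))\<^sup>2 \<le> L"
    and c: "c \<in> X" "(N (c - xstar))\<^sup>2 \<le> (R p)\<^sup>2"
  shows "amd_terminates (G c p)"
    and "real (amd_iterations (G c p)) \<le> 1 + 16 * \<Omega> * L / (\<mu>\<^sup>2 * R\<^sub>0\<^sup>2) * 2 ^ p"
proof -
  interpret amd: adaptive_mirror_descent "G c p" f xstar by (rule stage[OF c])
  have fields: "feasible (G c p) = X" "obj_subgrad (G c p) = gf" "constr_subgrad (G c p) = gg"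
    "inner_norm (G c p) = (\<lambda>u. N u / R p)" "inner_theta2 (G c p) = \<Omega> / 2"
    "inner_accuracy (G c p) = restart_accuracy \<mu> R\<^sub>0 (Suc p)"
    by (simp_all add: stage_input_def Let_def)
  have "(step_M (G c p) z)\<^sup>2 \<le> (R p)\<^sup>2 * L" if "z \<in> X" for z
  proof -
    let ?q = "step_subgrad (G c p) z"
    have "step_M (G c p) z \<le> R p * dual_norm N ?q" unfolding step_M_def fields
      using dual_norm_divide_le[OF norm restart_radius_pos[OF R0_pos]] .
    moreover have "0 \<le> step_M (G c p) z" unfolding step_M_def using dual_norm_nonneg[OF amd.norm] .
    ultimately have "(step_M (G c p) z)\<^sup>2 \<le> (R p)\<^sup>2 * (dual_norm N ?q)\<^sup>2"
      using power_mono[of _ _ 2] by (metis power_mult_distrib)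
    also have "\<dots> \<le> (R p)\<^sup>2 * L"
      using L[OF that] unfolding step_subgrad_def fields by (intro mult_left_mono) auto
    finally show ?thesis .
  qed
  note le = amd.iterations_le[of "(R p)\<^sup>2 * L", unfolded fields, OF this]
  show "amd_terminates (G c p)" by (rule le(1))
  have "2 * (\<Omega> / 2) * ((R p)\<^sup>2 * L) / (restart_accuracy \<mu> R\<^sub>0 (Suc p))\<^sup>2 = 16 * \<Omega> * L / (\<mu>\<^sup>2 * R\<^sub>0\<^sup>2) * 2 ^ p"
    using \<mu>_pos R0_pos unfolding restart_radius_square restart_accuracy_eq
    by (simp add: field_simps power2_eq_square)
  then show "real (amd_iterations (G c p)) \<le> 1 + 16 * \<Omega> * L / (\<mu>\<^sup>2 * R\<^sub>0\<^sup>2) * 2 ^ p" using le(2) by simp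
qed

lemma restart_complexity:
  assumes L: "\<And>z. z \<in> X \<Longrightarrow> (dual_norm N (gf z))\<^sup>2 \<le> L \<and> (dual_norm N (gg z))\<^sup>2 \<le> L"
  shows "restart_terminates G x\<^sub>0 P"
    and "real (restart_iterations G x\<^sub>0 P) \<le> real P + 16 * \<Omega> * L / (\<mu>\<^sup>2 * R\<^sub>0\<^sup>2) * 2 ^ P"
proof -
  let ?C = "16 * \<Omega> * L / (\<mu>\<^sup>2 * R\<^sub>0\<^sup>2)"
  have T: "restart_terminates G x\<^sub>0 p" for p
  proof (induction p)
    case (Suc p)
    then have "amd_terminates (G (x p) p)" using stage_iterations(1)[OF L] restart_point_near by blast
    with Suc show ?case unfolding restart_terminates_def by (auto simp: less_Suc_eq)
  qed (simp add: restart_terminates_def)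
  show "restart_terminates G x\<^sub>0 P" by (rule T)
  have "0 \<le> L" using L[OF x0_mem] zero_le_power2 order_trans by blast
  then have C: "0 \<le> ?C" using \<Omega>_nonneg by simp
  have "real (restart_iterations G x\<^sub>0 P) \<le> (\<Sum>p<P. 1 + ?C * 2 ^ p)"
    unfolding restart_iterations_def of_nat_sum
    using stage_iterations(2)[OF L] restart_point_near[OF T] by (intro sum_mono) blast
  also have "\<dots> = real P + ?C * (2 ^ P - 1)"
    unfolding sum.distrib sum_distrib_left[symmetric] by (simp add: geometric_sum)
  also have "\<dots> \<le> real P + ?C * 2 ^ P" using C by (intro add_left_mono mult_left_mono) auto
  finally show "real (restart_iterations G x\<^sub>0 P) \<le> real P + ?C * 2 ^ P" .
qed

end

section \<open>The number of stages\<close>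

lemma restart_stages_ge:
  "restart_stages \<mu> R \<epsilon> \<ge> 1" "real (restart_stages \<mu> R \<epsilon>) \<ge> log 2 (\<mu> * R\<^sup>2 / (2 * \<epsilon>))"
proof -
  let ?P = "\<lambda>p. p \<ge> 1 \<and> real p \<ge> log 2 (\<mu> * R\<^sup>2 / (2 * \<epsilon>))"
  have "?P (max 1 (nat \<lceil>log 2 (\<mu> * R\<^sup>2 / (2 * \<epsilon>))\<rceil>))" by linarith
  then have "?P (restart_stages \<mu> R \<epsilon>)" unfolding restart_stages_def by (rule LeastI)
  then show "restart_stages \<mu> R \<epsilon> \<ge> 1" "real (restart_stages \<mu> R \<epsilon>) \<ge> log 2 (\<mu> * R\<^sup>2 / (2 * \<epsilon>))" by auto
qed

lemma restart_accuracy_last_le: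
  assumes "\<mu> > 0" "R > 0" "\<epsilon> > 0"
  shows "restart_accuracy \<mu> R (restart_stages \<mu> R \<epsilon>) \<le> \<epsilon>"
proof -
  have "\<mu> * R\<^sup>2 / (2 * \<epsilon>) \<le> 2 ^ restart_stages \<mu> R \<epsilon>"
    using restart_stages_ge(2)[of \<mu> R \<epsilon>] assms
    by (simp add: log_le_iff powr_realpow)
  then show ?thesis using assms unfolding restart_accuracy_eq by (simp add: field_simps)
qed

lemma restart_stages_eq_ceiling:
  assumes "\<epsilon> > 0" "2 * \<epsilon> < \<mu> * R\<^sup>2"
  shows "int (restart_stages \<mu> R \<epsilon>) = \<lceil>log 2 (\<mu> * R\<^sup>2 / (2 * \<epsilon>))\<rceil>"
proof -
  let ?l = "log 2 (\<mu> * R\<^sup>2 / (2 * \<epsilon>))"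
  have l: "?l > 0" using assms by simp
  have "restart_stages \<mu> R \<epsilon> \<le> nat \<lceil>?l\<rceil>" unfolding restart_stages_def
    using l by (intro Least_le) linarith
  moreover have "\<lceil>?l\<rceil> \<le> int (restart_stages \<mu> R \<epsilon>)" using restart_stages_ge(2)[of \<mu> R \<epsilon>] by linarith
  ultimately show ?thesis using l by linarith
qed

text \<open>
  The last stage index makes the accuracy small enough but overshoots the logarithm by less than one, whence its power of
  two exceeds \<open>\<mu> R\<^sub>0\<^sup>2 / (2 \<epsilon>)\<close> by at most the factor two.
\<close>

lemma two_power_restart_stages_le:
  assumes "\<epsilon> > 0" "2 * \<epsilon> < \<mu> * R\<^sup>2"
  shows "2 ^ restart_stages \<mu> R \<epsilon> \<le> \<mu> * R\<^sup>2 / \<epsilon>"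
proof -
  let ?a = "\<mu> * R\<^sup>2 / (2 * \<epsilon>)"
  have a: "?a > 0" using assms by simp
  have "real (restart_stages \<mu> R \<epsilon>) \<le> 1 + log 2 ?a"
    using restart_stages_eq_ceiling[OF assms] by linarith
  then have "2 powr real (restart_stages \<mu> R \<epsilon>) \<le> 2 powr (1 + log 2 ?a)" by simp
  also have "\<dots> = 2 * ?a" using a by (simp only: powr_add) simp
  finally show ?thesis by (simp add: powr_realpow)
qed

section \<open>Accuracy and complexity of the restarted method\<close>

theorem theorem3:
  fixes N :: "'a::euclidean_space \<Rightarrow> real"
    and X :: "'a set"
    and f g :: "'a \<Rightarrow> real"
    and gf gg :: "'a \<Rightarrow> ('a \<Rightarrow>\<^sub>L real)"
    and d :: "'a \<Rightarrow> real"
    and gd :: "'a \<Rightarrow> ('a \<Rightarrow>\<^sub>L real)"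
    and \<mu> \<Omega> M\<^sub>f M\<^sub>g R\<^sub>0 \<epsilon> :: real
    and x\<^sub>0 xstar :: 'a
  assumes "is_norm N"
    and "closed X" and "convex X"
    and "convex_on X f" and "convex_on UNIV g"
    and "\<exists>xb\<in>rel_interior X. g xb < 0"
    and "is_arg_min f (\<lambda>x. x \<in> X \<and> g x \<le> 0) xstar"
    and "\<forall>x\<in>X. subgradient X f x (gf x)"
    and "\<forall>x\<in>X. subgradient UNIV g x (gg x)"
    and "lipschitz_wrt N M\<^sub>f X f" and "lipschitz_wrt N M\<^sub>g X g"
    and "\<mu> > 0"
    and "strongly_convex N \<mu> X X f" and "strongly_convex N \<mu> UNIV X g"
    and "\<forall>S\<in>prox_domains X R\<^sub>0. prox_function N S d gd"
    and "\<forall>S\<in>prox_domains X R\<^sub>0. \<forall>x\<in>S. N x \<le> 1 \<longrightarrow> d x \<le> \<Omega> / 2"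
    and "x\<^sub>0 \<in> X" and "R\<^sub>0 > 0" and "(N (x\<^sub>0 - xstar))\<^sup>2 \<le> R\<^sub>0\<^sup>2"
    and "\<epsilon> > 0"
  shows
    "let G = stage_input X g gf gg N d gd \<mu> \<Omega> R\<^sub>0;
         P = restart_stages \<mu> R\<^sub>0 \<epsilon>;
         x\<^sub>P = restart_point G x\<^sub>0 P
     in (restart_terminates G x\<^sub>0 P \<longrightarrow>
           f x\<^sub>P - f xstar \<le> \<epsilon> \<and> g x\<^sub>P \<le> \<epsilon> \<and> (N (x\<^sub>P - xstar))\<^sup>2 \<le> 2 * \<epsilon> / \<mu>) \<and>
        ((\<forall>x\<in>frontier X. dual_norm N (gf x) \<le> M\<^sub>f \<and> dual_norm N (gg x) \<le> M\<^sub>g) \<longrightarrow>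
           restart_terminates G x\<^sub>0 P \<and>
           (2 * \<epsilon> < \<mu> * R\<^sub>0\<^sup>2 \<longrightarrow>
              real (restart_iterations G x\<^sub>0 P) \<le>
                of_int \<lceil>log 2 (\<mu> * R\<^sub>0\<^sup>2 / (2 * \<epsilon>))\<rceil> +
                32 * \<Omega> * max (M\<^sub>f\<^sup>2) (M\<^sub>g\<^sup>2) / (\<mu> * \<epsilon>)))"
proof -
  interpret restarted_mirror_descent N X f g gf gg gd d \<mu> \<Omega> R\<^sub>0 x\<^sub>0 xstar
    using assms by unfold_locales
  define P where "P = restart_stages \<mu> R\<^sub>0 \<epsilon>"
  define L where "L = max (M\<^sub>f\<^sup>2) (M\<^sub>g\<^sup>2)"
  have "f (x P) - f xstar \<le> \<epsilon> \<and> g (x P) \<le> \<epsilon> \<and> (N (x P - xstar))\<^sup>2 \<le> 2 * \<epsilon> / \<mu>"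
    if "restart_terminates G x\<^sub>0 P"
  proof -
    have \<epsilon>: "restart_accuracy \<mu> R\<^sub>0 P \<le> \<epsilon>"
      unfolding P_def using restart_accuracy_last_le \<mu>_pos R0_pos \<open>\<epsilon> > 0\<close> by blast
    note acc = restart_point_accuracy[OF that] restart_stages_ge(1)[of \<mu> R\<^sub>0 \<epsilon>, folded P_def]
    have "\<mu> / 2 * (N (x P - xstar))\<^sup>2 \<le> \<epsilon>" using acc \<epsilon> by linarith
    then show ?thesis using acc \<epsilon> \<mu>_pos by (simp add: field_simps)
  qed
  moreover have "restart_terminates G x\<^sub>0 P \<and> (2 * \<epsilon> < \<mu> * R\<^sub>0\<^sup>2 \<longrightarrow>
      real (restart_iterations G x\<^sub>0 P) \<le>
        of_int \<lceil>log 2 (\<mu> * R\<^sub>0\<^sup>2 / (2 * \<epsilon>))\<rceil> + 32 * \<Omega> * L / (\<mu> * \<epsilon>))"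
    if fr: "\<forall>x\<in>frontier X. dual_norm N (gf x) \<le> M\<^sub>f \<and> dual_norm N (gg x) \<le> M\<^sub>g"
  proof -
    have bound: "(dual_norm N (gf z))\<^sup>2 \<le> L \<and> (dual_norm N (gg z))\<^sup>2 \<le> L" if z: "z \<in> X" for z
    proof -
      have "subgradient X g z (gg z)" using g_subgrad z by (auto simp: subgradient_def)
      \<comment> \<open>Interior points are covered by the Lipschitz constants, boundary points by the hypothesis \<open>fr\<close>.\<close>
      then have "z \<in> interior X \<Longrightarrow> dual_norm N (gf z) \<le> M\<^sub>f \<and> dual_norm N (gg z) \<le> M\<^sub>g"
        using dual_norm_subgradient_le_lipschitz[OF norm] assms(10,11) f_subgrad z by blast
      moreover have "z \<notin> interior X \<Longrightarrow> z \<in> frontier X"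
        using z closure_subset unfolding frontier_def by blast
      ultimately have "dual_norm N (gf z) \<le> M\<^sub>f" "dual_norm N (gg z) \<le> M\<^sub>g" using fr by blast+
      then have "(dual_norm N (gf z))\<^sup>2 \<le> M\<^sub>f\<^sup>2" "(dual_norm N (gg z))\<^sup>2 \<le> M\<^sub>g\<^sup>2"
        using dual_norm_nonneg[OF norm] by (auto intro: power_mono)
      then show ?thesis unfolding L_def by auto
    qed
    have "real (restart_iterations G x\<^sub>0 P) \<le>
        of_int \<lceil>log 2 (\<mu> * R\<^sub>0\<^sup>2 / (2 * \<epsilon>))\<rceil> + 32 * \<Omega> * L / (\<mu> * \<epsilon>)"
      if \<epsilon>: "2 * \<epsilon> < \<mu> * R\<^sub>0\<^sup>2"
    proof -
      have "0 \<le> L" unfolding L_def by (simp add: le_max_iff_disj)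
      then have nonneg: "0 \<le> 16 * \<Omega> * L" using \<Omega>_nonneg by simp
      have "real (restart_iterations G x\<^sub>0 P) \<le> real P + 16 * \<Omega> * L / (\<mu>\<^sup>2 * R\<^sub>0\<^sup>2) * 2 ^ P"
        by (rule restart_complexity(2)[OF bound])
      also have "16 * \<Omega> * L / (\<mu>\<^sup>2 * R\<^sub>0\<^sup>2) * 2 ^ P \<le> 16 * \<Omega> * L / (\<mu>\<^sup>2 * R\<^sub>0\<^sup>2) * (\<mu> * R\<^sub>0\<^sup>2 / \<epsilon>)"
        unfolding P_def using nonneg two_power_restart_stages_le[OF \<open>\<epsilon> > 0\<close> \<epsilon>]
        by (intro mult_left_mono) auto
      also have "\<dots> = 16 * \<Omega> * L / (\<mu> * \<epsilon>)"
        using \<mu>_pos R0_pos by (simp add: field_simps power2_eq_square)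
      also have "\<dots> \<le> 32 * \<Omega> * L / (\<mu> * \<epsilon>)"
        using nonneg \<mu>_pos \<open>\<epsilon> > 0\<close> by (intro divide_right_mono) auto
      also have "real P = of_int \<lceil>log 2 (\<mu> * R\<^sub>0\<^sup>2 / (2 * \<epsilon>))\<rceil>"
        unfolding P_def using restart_stages_eq_ceiling[OF \<open>\<epsilon> > 0\<close> \<epsilon>] by (metis of_int_of_nat_eq)
      finally show ?thesis by simp
    qed
    then show ?thesis using restart_complexity(1)[OF bound] by blast
  qed
  ultimately show ?thesis unfolding Let_def P_def L_def by blast
qed

end
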